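(* Let $\mathcal M^1_{K_3}$ (resp. $\mathcal M^2_{K_3}$) be the graph property of being Maker's win in the $(1:1)$ Maker-Breaker vertex $K_3$-game where Maker moves first (resp. second). For the random graph process $\tilde G$ on $n$ vertices, w.h.p. $\tau(\tilde G,\mathcal M^1_{K_3})=\tau(\tilde G,\mathcal G_{DD})$ and $\tau(\tilde G,\mathcal M^2_{K_3})=\tau(\tilde G,\mathcal G_{2DD})$.
   Context: The $(1:1)$ Maker-Breaker vertex $K_3$-game on a graph $G$: Maker and Breaker alternately claim one previously unclaimed vertex of $G$ each until all vertices are claimed; Maker wins if the subgraph of $G$ induced by his vertices contains a triangle, otherwise Breaker wins. The random graph process on $[n]$: order the $m=\binom n2$ edges of $K_n$ by a uniformly random permutation and let $G_i$ be the graph on $[n]$ with the first $i$ edges, $\tilde G=(G_i)_{i=0}^m$. For a monotone increasing property $\mathcal P$, $\tau(\tilde G,\mathcal P)=\min\{i: G_i\in\mathcal P\}$. A double diamond $DD$ is the graph on vertices $x,y_1,z_1,z_2,y_2,z_3,z_4$ with edges $xy_1,xz_1,xz_2,y_1z_1,y_1z_2,xy_2,xz_3,xz_4,y_2z_3,y_2z_4$ (two copies of $K_4$ minus an edge, sharing the single vertex $x$). For a graph $F$ and integer $k$, $\mathcal G_{kF}$ is the property of containing $k$ (possibly intersecting) copies of $F$, and $\mathcal G_F=\mathcal G_{1F}$. "W.h.p." means with probability tending to 1 as $n\to\infty$. *)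

theory Defs
  imports Complex_Main "HOL-Combinatorics.Multiset_Permutations"
begin

definition Kn_edges :: "nat \<Rightarrow> nat set set" where
  "Kn_edges n = {e. \<exists>a b. a < n \<and> b < n \<and> a \<noteq> b \<and> e = {a, b}}"

definition proc_graph :: "nat set list \<Rightarrow> nat \<Rightarrow> nat set set" where
  "proc_graph es i = set (take i es)"

definition hitting_time :: "nat set list \<Rightarrow> (nat set set \<Rightarrow> bool) \<Rightarrow> nat option" where
  "hitting_time es P =
     (if \<exists>i \<le> length es. P (proc_graph es i)
      then Some (LEAST i. P (proc_graph es i)) else None)"

definition has_triangle :: "nat set set \<Rightarrow> nat set \<Rightarrow> bool" where
  "has_triangle E M = (\<exists>a\<in>M. \<exists>b\<in>M. \<exists>c\<in>M. a \<noteq> b \<and> b \<noteq> c \<and> a \<noteq> c \<and>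
       {a, b} \<in> E \<and> {b, c} \<in> E \<and> {a, c} \<in> E)"

text \<open>Maker-Breaker vertex K3-game on vertex set V with edges E.
  mwin_M V E M B: Maker to move, can force a win from the position (M, B).
  mwin_B V E M B: Breaker to move, Maker can force a win.\<close>
inductive mwin_M :: "nat set \<Rightarrow> nat set set \<Rightarrow> nat set \<Rightarrow> nat set \<Rightarrow> bool"
  and mwin_B :: "nat set \<Rightarrow> nat set set \<Rightarrow> nat set \<Rightarrow> nat set \<Rightarrow> bool"
  for V E where
  triM: "has_triangle E M \<Longrightarrow> mwin_M V E M B"
| triB: "has_triangle E M \<Longrightarrow> mwin_B V E M B"
| moveM: "v \<in> V \<Longrightarrow> v \<notin> M \<Longrightarrow> v \<notin> B \<Longrightarrow> mwin_B V E (insert v M) B \<Longrightarrow> mwin_M V E M B"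
| moveB: "V - M - B \<noteq> {} \<Longrightarrow> (\<forall>v \<in> V - M - B. mwin_M V E M (insert v B)) \<Longrightarrow> mwin_B V E M B"

definition maker_first_win :: "nat \<Rightarrow> nat set set \<Rightarrow> bool" where
  "maker_first_win n E = mwin_M {0..<n} E {} {}"

definition maker_second_win :: "nat \<Rightarrow> nat set set \<Rightarrow> bool" where
  "maker_second_win n E = mwin_B {0..<n} E {} {}"

text \<open>Double diamond on vertices x=0, y1=1, z1=2, z2=3, y2=4, z3=5, z4=6.\<close>
definition DD_edges :: "nat set set" where
  "DD_edges = {{0,1},{0,2},{0,3},{1,2},{1,3},{0,4},{0,5},{0,6},{4,5},{4,6}}"

definition DD_copies :: "nat set set \<Rightarrow> nat set set set" where
  "DD_copies E = {(\<lambda>e. f ` e) ` DD_edges | f. inj_on f {0..<7} \<and> (\<lambda>e. f ` e) ` DD_edges \<subseteq> E}"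

definition has_k_DD :: "nat \<Rightarrow> nat set set \<Rightarrow> bool" where
  "has_k_DD k E = (card (DD_copies E) \<ge> k)"

definition proc_prob :: "nat \<Rightarrow> (nat set list \<Rightarrow> bool) \<Rightarrow> real" where
  "proc_prob n Q = real (card {es \<in> permutations_of_set (Kn_edges n). Q es})
                   / real (card (permutations_of_set (Kn_edges n)))"

end

theory Submission
  imports Defs
begin

text \<open>
  Give a vertex set \<open>S\<close> of a graph the weight \<open>10 |S| - 7 e(S)\<close>. Up to a time slightly after the
  double diamond threshold, i.e. at density \<open>n powr -0.699\<close>, the first moment method shows that
  w.h.p. no set of at most 23 vertices has negative weight (the graph is sparse), and the second
  moment method that there are two double diamonds.

  In a sparse graph the theorem is deterministic. The double diamond has weight 0 and its proper
  subgraphs have positive weight, so distinct copies are vertex-disjoint. Maker wins on a double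
  diamond by taking its centre, and with two disjoint copies he can afford to move second.
  Conversely, without a double diamond the vertices can be paired off so that every triangle contains
  a pair, and Breaker wins by answering inside the pairs; if there is a unique double diamond and
  Breaker starts, he first takes its centre. For the pairing, consider a minimal family of triangles
  that admits none. It is connected, and each of its triangles has at most one private vertex.
  Attaching a triangle by a vertex costs weight at least 1, by an edge at least 4, so starting from a
  triangle (weight at most 9) the family is small, by counting it contains two triangles with a common
  edge (weight at most 5), and from there only a handful of configurations remain, of which the
  double diamond is the only one without a pairing.
\<close>

section \<open>The game\<close>

lemma maker_wins_diamond:
  assumes "x \<in> M" "{y, z1, z2} \<subseteq> V - M - B" "y \<noteq> z1" "y \<noteq> z2" "z1 \<noteq> z2"
    and "{x, y} \<in> E" "{x, z1} \<in> E" "{x, z2} \<in> E" "{y, z1} \<in> E" "{y, z2} \<in> E"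
  shows "mwin_M V E M B"
proof (rule moveM)
  show "mwin_B V E (insert y M) B"
  proof (rule moveB)
    show "V - insert y M - B \<noteq> {}" using assms by blast
    show "\<forall>v\<in>V - insert y M - B. mwin_M V E (insert y M) (insert v B)"
    proof
      fix v assume "v \<in> V - insert y M - B"
      \<comment> \<open>The move \<open>y\<close> threatens to close a triangle at \<open>z1\<close>
        and at \<open>z2\<close>; \<open>v\<close> blocks only one of them.\<close>
      obtain z where z: "z \<in> {z1, z2}" "z \<noteq> v" using assms(5) by blast
      have "has_triangle E (insert z (insert y M))"
        unfolding has_triangle_def using assms z
        by (intro bexI[of _ x] bexI[of _ y] bexI[of _ z]) auto
      then show "mwin_M V E (insert y M) (insert v B)"
        using z assms by (intro moveM[of z]) (auto intro: triB)
    qed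
  qed
qed (use assms in auto)

text \<open>After Maker takes the centre \<open>f 0\<close>, Breaker's reply touches at most one of
  the two diamonds, and the intact one is won by \<open>maker_wins_diamond\<close>.\<close>

lemma maker_wins_DD:
  assumes inj: "inj_on f {0..<7}" and sub: "(\<lambda>e. f ` e) ` DD_edges \<subseteq> E"
    and V: "f ` {0..<7} \<subseteq> V - B"
  shows "mwin_M V E {} B"
proof -
  have neq: "f i \<noteq> f j" if "i < 7" "j < 7" "i \<noteq> j" for i j
    using inj that by (auto simp: inj_on_def)
  have mem: "f i \<in> V - B" if "i < 7" for i
    using V that by (meson atLeastLessThan_iff image_subset_iff zero_le)
  have edges: "{f 0, f 1} \<in> E" "{f 0, f 2} \<in> E" "{f 0, f 3} \<in> E" "{f 1, f 2} \<in> E" "{f 1, f 3} \<in> E"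
    "{f 0, f 4} \<in> E" "{f 0, f 5} \<in> E" "{f 0, f 6} \<in> E" "{f 4, f 5} \<in> E" "{f 4, f 6} \<in> E"
    using sub by (auto simp: DD_edges_def)
  show ?thesis
  proof (rule moveM)
    show "mwin_B V E (insert (f 0) {}) B"
    proof (rule moveB)
      show "V - {f 0} - B \<noteq> {}" using mem[of 1] neq[of 1 0] by auto
      show "\<forall>v\<in>V - {f 0} - B. mwin_M V E {f 0} (insert v B)"
      proof
        fix v assume "v \<in> V - {f 0} - B"
        show "mwin_M V E {f 0} (insert v B)"
        proof (cases "v \<in> {f 1, f 2, f 3}")
          case True
          then have "v \<notin> {f 4, f 5, f 6}" by (auto simp: neq)
          then show ?thesis using edges mem neq
            by (intro maker_wins_diamond[of "f 0" _ "f 4" "f 5" "f 6"]) auto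
        next
          case False
          then show ?thesis using edges mem neq
            by (intro maker_wins_diamond[of "f 0" _ "f 1" "f 2" "f 3"]) auto
        qed
      qed
    qed
  qed (use mem[of 0] in auto)
qed

section \<open>Breaker's pairing strategy\<close>

definition triangles :: "'a set set \<Rightarrow> 'a set set" where
  "triangles G = {T. card T = 3 \<and> (\<forall>u\<in>T. \<forall>v\<in>T. u \<noteq> v \<longrightarrow> {u, v} \<in> G)}"

lemma has_triangle_imp_triangles:
  assumes "has_triangle E M"
  obtains T where "T \<in> triangles E" "T \<subseteq> M"
proof -
  from assms obtain a b c where abc: "a \<in> M" "b \<in> M" "c \<in> M" "a \<noteq> b" "b \<noteq> c" "a \<noteq> c"
      "{a, b} \<in> E" "{b, c} \<in> E" "{a, c} \<in> E"
    unfolding has_triangle_def by blast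
  then have "{a, b, c} \<in> triangles E"
    by (auto simp: triangles_def insert_commute)
  with abc that show thesis by blast
qed

text \<open>Confining the pairs to the vertices of the family allows pairings of families on
  disjoint vertex sets to be united, and keeps Breaker's replies on the board.\<close>

definition pairable :: "'a set set \<Rightarrow> bool" where
  "pairable \<T> \<longleftrightarrow> (\<exists>P. (\<forall>p\<in>P. card p = 2) \<and> disjoint P \<and> \<Union>P \<subseteq> \<Union>\<T> \<and> (\<forall>T\<in>\<T>. \<exists>p\<in>P. p \<subseteq> T))"

lemma pairableI:
  assumes "\<And>p. p \<in> P \<Longrightarrow> card p = 2" "disjoint P" "\<And>T. T \<in> \<T> \<Longrightarrow> \<exists>p\<in>P. p \<subseteq> T"
  shows "pairable \<T>"
proof -
  let ?Q = "{p \<in> P. \<exists>T\<in>\<T>. p \<subseteq> T}"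
  have "disjoint ?Q" using assms(2) by (auto simp: disjoint_def)
  then show ?thesis unfolding pairable_def
    by (intro exI[of _ ?Q]) (use assms in blast)
qed

text \<open>Breaker answers inside the pair of Maker's last move. If there is nothing to answer, he plays
  an arbitrary vertex; the invariant is stable under such moves.\<close>
definition breaker_safe :: "nat set set \<Rightarrow> nat set set \<Rightarrow> nat set \<Rightarrow> nat set \<Rightarrow> bool" where
  "breaker_safe E P M B \<longleftrightarrow> M \<inter> B = {} \<and>
     (\<forall>T\<in>triangles E. T \<inter> B \<noteq> {} \<or> (\<exists>p\<in>P. p \<subseteq> T \<and> p \<inter> M = {}))"

lemma breaker_safe_no_triangle:
  assumes "breaker_safe E P M B" "\<And>p. p \<in> P \<Longrightarrow> card p = 2"
  shows "\<not> has_triangle E M"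
proof
  assume "has_triangle E M"
  then obtain T where T: "T \<in> triangles E" "T \<subseteq> M" by (rule has_triangle_imp_triangles)
  with assms(1) obtain p where "p \<in> P" "p \<subseteq> T" "p \<inter> M = {}"
    unfolding breaker_safe_def by blast
  then have "p = {}" using T by blast
  then show False using assms(2)[OF \<open>p \<in> P\<close>] by simp
qed

text \<open>If \<open>v\<close> has a free partner, Breaker takes it. Otherwise no wholly unclaimed
  pair contains \<open>v\<close>, so the pairs guarding the triangles that miss \<open>B\<close>
  survive Maker's move, and any free vertex \<open>w\<close> will do.\<close>

lemma breaker_response:
  assumes safe: "breaker_safe E P M B" and P: "\<And>p. p \<in> P \<Longrightarrow> card p = 2" "disjoint P"
    and v: "v \<notin> M" "v \<notin> B" and W: "w \<in> V - insert v M - B" and PV: "\<Union>P \<subseteq> V"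
  shows "\<exists>u\<in>V - insert v M - B. breaker_safe E P (insert v M) (insert u B)"
proof (cases "\<exists>u. {v, u} \<in> P \<and> u \<noteq> v \<and> u \<notin> M \<and> u \<notin> B")
  case True
  then obtain u where u: "{v, u} \<in> P" "u \<noteq> v" "u \<notin> M" "u \<notin> B" by blast
  have "breaker_safe E P (insert v M) (insert u B)"
    unfolding breaker_safe_def
  proof (intro conjI ballI)
    show "insert v M \<inter> insert u B = {}" using safe u v by (auto simp: breaker_safe_def)
    fix T assume "T \<in> triangles E"
    then consider "T \<inter> B \<noteq> {}" | p where "p \<in> P" "p \<subseteq> T" "p \<inter> M = {}"
      using safe unfolding breaker_safe_def by blast
    then show "T \<inter> insert u B \<noteq> {} \<or> (\<exists>p\<in>P. p \<subseteq> T \<and> p \<inter> insert v M = {})"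
    proof cases
      case 2
      then show ?thesis
      proof (cases "v \<in> p")
        case True
        \<comment> \<open>Disjointness makes \<open>{v, u}\<close> the only pair through
          \<open>v\<close>, and \<open>u\<close> now belongs to Breaker.\<close>
        then have "p = {v, u}" using 2(1) u(1) disjointD[OF P(2)] by blast
        then show ?thesis using 2 by auto
      qed blast
    qed blast
  qed
  then show ?thesis using u PV by (intro bexI[of _ u]) auto
next
  case False
  have "breaker_safe E P (insert v M) (insert w B)"
    unfolding breaker_safe_def
  proof (intro conjI ballI)
    show "insert v M \<inter> insert w B = {}" using safe W v by (auto simp: breaker_safe_def)
    fix T assume "T \<in> triangles E"
    then consider "T \<inter> B \<noteq> {}" | p where "p \<in> P" "p \<subseteq> T" "p \<inter> M = {}" "T \<inter> B = {}"
      using safe unfolding breaker_safe_def by blast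
    then show "T \<inter> insert w B \<noteq> {} \<or> (\<exists>p\<in>P. p \<subseteq> T \<and> p \<inter> insert v M = {})"
    proof cases
      case 2
      have "v \<notin> p"
      proof
        assume "v \<in> p"
        then obtain u where "p = {v, u}" "u \<noteq> v"
          using P(1)[OF 2(1)] by (auto simp: card_2_iff)
        then show False using False 2 by blast
      qed
      then show ?thesis using 2 by blast
    qed blast
  qed
  then show ?thesis using W by blast
qed

text \<open>Induction over Maker's winning positions: safety would have to be lost at some move of
  Maker, but \<open>breaker_response\<close> always restores it.\<close>

lemma breaker_safe_not_mwin_M:
  assumes "breaker_safe E P M B" and P: "\<And>p. p \<in> P \<Longrightarrow> card p = 2" "disjoint P" "\<Union>P \<subseteq> V"
  shows "\<not> mwin_M V E M B"
proof -
  \<comment> \<open>The companion claim for Breaker's turn: unless Maker already has a triangle, a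
    vertex is free but no reply is safe. \<open>moveB\<close> demands a free vertex, so a full board
    is no win for Maker.\<close>
  have "mwin_M V E M B \<Longrightarrow> \<not> breaker_safe E P M B"
    and "mwin_B V E M B \<Longrightarrow> \<not> has_triangle E M \<Longrightarrow>
      \<not> (\<exists>u\<in>V - M - B. breaker_safe E P M (insert u B)) \<and> V - M - B \<noteq> {}" for M B
  proof (induction rule: mwin_M_mwin_B.inducts)
    case (triM M B)
    then show ?case using breaker_safe_no_triangle P(1) by blast
  next
    case (moveM v M B)
    show ?case
    proof
      assume safe: "breaker_safe E P M B"
      show False
      proof (cases "has_triangle E (insert v M)")
        case True
        then obtain T where T: "T \<in> triangles E" "T \<subseteq> insert v M" by (rule has_triangle_imp_triangles)
        have "M \<inter> B = {}" using safe by (simp add: breaker_safe_def)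
        then have "T \<inter> B = {}" using T(2) \<open>v \<notin> B\<close> by auto
        then obtain p where p: "p \<in> P" "p \<subseteq> T" "p \<inter> M = {}"
          using safe T(1) unfolding breaker_safe_def by blast
        \<comment> \<open>A guarding pair avoids \<open>M\<close>, so in the completed triangle only
          the new vertex \<open>v\<close> is left for it.\<close>
        then have "p \<subseteq> {v}" using T by auto
        then show False using P(1)[OF p(1)] card_mono[of "{v}" p] by simp
      next
        case False
        with moveM.IH have "\<not> (\<exists>u\<in>V - insert v M - B. breaker_safe E P (insert v M) (insert u B))"
          "V - insert v M - B \<noteq> {}" by auto
        then show False
          using breaker_response[OF safe P(1,2) \<open>v \<notin> M\<close> \<open>v \<notin> B\<close> _ P(3)] by blast
      qed
    qed
  qed blast+
  then show ?thesis using assms(1) by blast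
qed

text \<open>Triangles meeting \<open>B\<close> are already dead, so only those of the graph without
  \<open>B\<close> have to be paired. The empty \<open>B\<close> is the game that Maker starts;
  \<open>B = {x}\<close> is the one that Breaker has opened at \<open>x\<close>.\<close>

lemma pairing_strategy:
  assumes "pairable (triangles {e \<in> E. e \<inter> B = {}})" "\<Union>E \<subseteq> V"
  shows "\<not> mwin_M V E {} B"
proof -
  let ?G = "{e \<in> E. e \<inter> B = {}}"
  obtain P where P: "\<forall>p\<in>P. card p = 2" "disjoint P" "\<Union>P \<subseteq> \<Union>(triangles ?G)"
    "\<forall>T\<in>triangles ?G. \<exists>p\<in>P. p \<subseteq> T"
    using assms(1) unfolding pairable_def by (elim exE conjE)
  have "v \<in> V" if "v \<in> T" "T \<in> triangles ?G" for v T
  proof -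
    have "card T = 3" using that by (simp add: triangles_def)
    then have "\<not> T \<subseteq> {v}" using card_mono[of "{v}" T] by auto
    then obtain u where "u \<in> T" "u \<noteq> v" by blast
    then have "{v, u} \<in> E" using that by (auto simp: triangles_def)
    then show ?thesis using assms(2) by auto
  qed
  then have PV: "\<Union>P \<subseteq> V" using P(3) by blast
  have "breaker_safe E P {} B"
    unfolding breaker_safe_def
  proof (intro conjI ballI)
    fix T assume T: "T \<in> triangles E"
    show "T \<inter> B \<noteq> {} \<or> (\<exists>p\<in>P. p \<subseteq> T \<and> p \<inter> {} = {})"
    proof (cases "T \<inter> B = {}")
      case True
      then have "T \<in> triangles ?G" using T by (auto simp: triangles_def)
      then show ?thesis using P(4) by auto
    qed auto
  qed auto
  then show ?thesis using breaker_safe_not_mwin_M P(1,2) PV by blast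
qed

section \<open>Sparse graphs\<close>

definition wt :: "'a set set \<Rightarrow> 'a set \<Rightarrow> int" where
  "wt G S = 10 * int (card S) - 7 * int (card {e \<in> G. e \<subseteq> S})"

text \<open>The bound 23: \<open>card S + 2 * wt G S\<close> is at most 21 for a triangle and does not increase when a
  triangle is attached to \<open>S\<close>, so \<open>S\<close> has at most 21 vertices as long as its weight is nonnegative,
  and one more triangle adds at most 2.\<close>
definition sparse :: "'a set set \<Rightarrow> bool" where
  "sparse G \<longleftrightarrow> (\<forall>S. finite S \<and> card S \<le> 23 \<longrightarrow> 0 \<le> wt G S)"

lemma sparseD: "sparse G \<Longrightarrow> finite S \<Longrightarrow> card S \<le> 23 \<Longrightarrow> 0 \<le> wt G S"
  by (simp add: sparse_def)

text \<open>This transfers sparseness from one time of the process to all earlier ones, and to the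
  graph left after Breaker's opening move.\<close>

lemma sparse_subset:
  assumes "sparse H" "G \<subseteq> H" "finite H"
  shows "sparse G"
  unfolding sparse_def
proof (intro allI impI)
  fix S :: "'a set" assume S: "finite S \<and> card S \<le> 23"
  have "card {e \<in> G. e \<subseteq> S} \<le> card {e \<in> H. e \<subseteq> S}"
    using assms by (intro card_mono) auto
  then show "0 \<le> wt G S"
    using sparseD[OF assms(1), of S] S by (simp add: wt_def)
qed

lemma wt_Un_le:
  assumes "finite G" "finite S" "finite N" "S \<inter> N = {}"
    and F: "F \<subseteq> G" "\<And>e. e \<in> F \<Longrightarrow> e \<subseteq> S \<union> N \<and> \<not> e \<subseteq> S"
  shows "wt G (S \<union> N) \<le> wt G S + 10 * int (card N) - 7 * int (card F)"
proof -
  have "card {e \<in> G. e \<subseteq> S} + card F = card ({e \<in> G. e \<subseteq> S} \<union> F)"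
    using assms finite_subset[OF F(1)] by (intro card_Un_disjoint[symmetric]) auto
  also have "\<dots> \<le> card {e \<in> G. e \<subseteq> S \<union> N}"
    using assms by (intro card_mono) auto
  finally show ?thesis
    using assms card_Un_disjoint[of S N] by (simp add: wt_def)
qed

text \<open>One vertex and two edges change the weight by 10 - 14; a third edge costs another
  7.\<close>

lemma wt_one_new:
  assumes "finite G" "finite S" "t \<notin> S" "p \<in> S" "q \<in> S" "p \<noteq> q" "{t, p} \<in> G" "{t, q} \<in> G"
  shows "wt G (insert t S) \<le> wt G S - 4"
    and "a \<in> S \<Longrightarrow> a \<notin> {p, q} \<Longrightarrow> {t, a} \<in> G \<Longrightarrow> wt G (insert t S) \<le> wt G S - 11"
proof -
  show "wt G (insert t S) \<le> wt G S - 4"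
    using wt_Un_le[of G S "{t}" "{{t, p}, {t, q}}"] assms by (auto simp: doubleton_eq_iff)
  assume a: "a \<in> S" "a \<notin> {p, q}" "{t, a} \<in> G"
  have "card {{t, p}, {t, q}, {t, a}} = 3" using a assms by (auto simp: doubleton_eq_iff)
  then show "wt G (insert t S) \<le> wt G S - 11"
    using wt_Un_le[of G S "{t}" "{{t, p}, {t, q}, {t, a}}"] assms a by auto
qed

text \<open>Two vertices and three edges change the weight by 20 - 21; a fourth edge costs another
  7.\<close>

lemma wt_two_new:
  assumes "finite G" "finite S" "u \<notin> S" "v \<notin> S" "u \<noteq> v" "s \<in> S"
    and "{u, v} \<in> G" "{u, s} \<in> G" "{v, s} \<in> G"
  shows "wt G (insert u (insert v S)) \<le> wt G S - 1"
    and "a \<in> S \<Longrightarrow> a \<noteq> s \<Longrightarrow> {u, a} \<in> G \<or> {v, a} \<in> G \<Longrightarrow> wt G (insert u (insert v S)) \<le> wt G S - 8"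
proof -
  have "u \<noteq> s" "v \<noteq> s" using assms by auto
  then have "card {{u, v}, {u, s}, {v, s}} = 3" using assms(5) by (simp add: doubleton_eq_iff)
  then show "wt G (insert u (insert v S)) \<le> wt G S - 1"
    using wt_Un_le[of G S "{u, v}" "{{u, v}, {u, s}, {v, s}}"] assms by auto
  have ext: "wt G (insert u (insert v S)) \<le> wt G S - 8"
    if "a \<in> S" "a \<noteq> s" "u \<notin> S" "v \<notin> S" "u \<noteq> v" "{u, v} \<in> G" "{u, s} \<in> G" "{v, s} \<in> G" "{u, a} \<in> G"
    for u v
  proof -
    have "u \<noteq> s" "v \<noteq> s" "u \<noteq> a" "v \<noteq> a" using that assms(6) by auto
    then have "card {{u, v}, {u, s}, {v, s}, {u, a}} = 4" using that by (simp add: doubleton_eq_iff)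
    then show ?thesis
      using wt_Un_le[of G S "{u, v}" "{{u, v}, {u, s}, {v, s}, {u, a}}"] that assms(1,2,6) by auto
  qed
  assume a: "a \<in> S" "a \<noteq> s" and e: "{u, a} \<in> G \<or> {v, a} \<in> G"
  from e show "wt G (insert u (insert v S)) \<le> wt G S - 8"
  proof
    assume "{u, a} \<in> G"
    then show ?thesis using ext[of u v] a assms by auto
  next
    assume "{v, a} \<in> G"
    then show ?thesis using ext[of v u] a assms by (auto simp: insert_commute)
  qed
qed

section \<open>Growing a vertex set by attaching triangles\<close>

lemma triangle_finite: "T \<in> triangles G \<Longrightarrow> finite T"
  by (auto simp: triangles_def intro: card_ge_0_finite)

lemma triangle_edge: "T \<in> triangles G \<Longrightarrow> u \<in> T \<Longrightarrow> v \<in> T \<Longrightarrow> u \<noteq> v \<Longrightarrow> {u, v} \<in> G"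
  by (auto simp: triangles_def)

text \<open>Connectedness is phrased as an exploration because inverting the rules exposes the
  triangles attached last, on which the case analysis of \<open>ex_DD\<close> runs.\<close>

inductive reach :: "'a set set \<Rightarrow> 'a set \<Rightarrow> 'a set \<Rightarrow> bool" for \<T> A where
  start: "reach \<T> A A"
| attach: "reach \<T> A S \<Longrightarrow> T \<in> \<T> \<Longrightarrow> T \<inter> S \<noteq> {} \<Longrightarrow> \<not> T \<subseteq> S \<Longrightarrow> reach \<T> A (S \<union> T)"

lemma attach_cases:
  assumes "T \<in> triangles G" "T \<inter> S \<noteq> {}" "\<not> T \<subseteq> S"
  obtains (one) t p q where "T = {t, p, q}" "t \<notin> S" "p \<in> S" "q \<in> S" "p \<noteq> q" "S \<union> T = insert t S"
      "{t, p} \<in> G" "{t, q} \<in> G" "{p, q} \<in> G"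
  | (two) u v s where "T = {u, v, s}" "u \<notin> S" "v \<notin> S" "u \<noteq> v" "s \<in> S" "S \<union> T = insert u (insert v S)"
      "{u, v} \<in> G" "{u, s} \<in> G" "{v, s} \<in> G"
proof -
  obtain u s where us: "u \<in> T" "u \<notin> S" "s \<in> T" "s \<in> S" using assms by blast
  have "card T = 3" using assms(1) by (simp add: triangles_def)
  moreover have "u \<noteq> s" using us by blast
  ultimately have "card (T - {u, s}) = 1" using us by (subst card_Diff_subset) auto
  then obtain v where "T - {u, s} = {v}" by (auto simp: card_1_singleton_iff)
  then have v: "T = {u, v, s}" "v \<noteq> u" "v \<noteq> s" using us by auto
  have e: "{u, v} \<in> G" "{u, s} \<in> G" "{v, s} \<in> G"
    using triangle_edge[OF assms(1)] v us by auto
  show thesis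
  proof (cases "v \<in> S")
    case True
    then show thesis using one[of u v s] us v e by auto
  next
    case False
    then show thesis using two[of u v s] us v e by auto
  qed
qed

locale triangle_family =
  fixes G :: "'a set set" and \<T> :: "'a set set"
  assumes fin: "finite G" and sparse: "sparse G" and tri: "\<T> \<subseteq> triangles G"
begin

text \<open>Two new vertices are paid for by a weight loss of at least 1, one new vertex by a loss
  of at least 4, so \<open>card S + 2 * wt G S\<close> never grows. The last clause records that any
  attachment at all loses weight.\<close>

lemma reach_props:
  assumes "reach \<T> A S" and A: "finite A" "int (card A) + 2 * wt G A \<le> 21" "card A \<le> 23"
  shows "finite S \<and> A \<subseteq> S \<and> S \<subseteq> A \<union> \<Union>\<T> \<and> card S \<le> 21 \<and> int (card S) + 2 * wt G S \<le> 21
     \<and> 0 \<le> wt G S \<and> (S = A \<or> wt G S \<le> wt G A - 1)"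
  using assms(1)
proof (induction rule: reach.induct)
  case start
  have "0 \<le> wt G A" using sparseD[OF sparse] A by auto
  then show ?case using A by auto
next
  case (attach S T)
  have "T \<in> triangles G" using attach tri by blast
  from this attach(3,4) show ?case
  proof (cases rule: attach_cases)
    case (one t p q)
    have "wt G (S \<union> T) \<le> wt G S - 4" "card (S \<union> T) = Suc (card S)"
      using one wt_one_new(1)[of G S t p q] fin attach.IH by auto
    moreover from this have "0 \<le> wt G (S \<union> T)"
      using attach.IH one by (intro sparseD[OF sparse]) auto
    ultimately show ?thesis using attach.IH attach.hyps triangle_finite[OF \<open>T \<in> triangles G\<close>] by auto
  next
    case (two u v s)
    have "wt G (S \<union> T) \<le> wt G S - 1" "card (S \<union> T) = Suc (Suc (card S))"
      using two wt_two_new(1)[of G S u v s] fin attach.IH by auto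
    moreover from this have "0 \<le> wt G (S \<union> T)"
      using attach.IH two by (intro sparseD[OF sparse]) auto
    ultimately show ?thesis using attach.IH attach.hyps triangle_finite[OF \<open>T \<in> triangles G\<close>] by auto
  qed
qed

end

section \<open>Minimal families of triangles without a pairing\<close>

locale minimal_family = triangle_family +
  assumes not_pairable: "\<not> pairable \<T>"
    and minimal: "\<And>\<S>. \<S> \<subset> \<T> \<Longrightarrow> pairable \<S>"
begin

abbreviation "V \<equiv> \<Union>\<T>"

text \<open>Otherwise the family splits into the triangles inside \<open>S\<close> and those missing
  \<open>S\<close>. Both parts are proper, hence pairable, and their pairings live on disjoint
  vertex sets.\<close>

lemma connected:
  assumes "S \<inter> V \<noteq> {}" "\<not> V \<subseteq> S"
  shows "\<exists>T\<in>\<T>. T \<inter> S \<noteq> {} \<and> \<not> T \<subseteq> S"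
proof (rule ccontr)
  assume neg: "\<not> ?thesis"
  let ?A = "{T \<in> \<T>. T \<inter> S = {}}" and ?B = "{T \<in> \<T>. T \<subseteq> S}"
  have "?A \<subset> \<T>" "?B \<subset> \<T>" using assms by blast+
  then have "pairable ?A" "pairable ?B" using minimal by blast+
  then obtain P Q where P: "\<forall>p\<in>P. card p = 2" "disjoint P" "\<Union>P \<subseteq> \<Union>?A" "\<forall>T\<in>?A. \<exists>p\<in>P. p \<subseteq> T"
    and Q: "\<forall>p\<in>Q. card p = 2" "disjoint Q" "\<Union>Q \<subseteq> \<Union>?B" "\<forall>T\<in>?B. \<exists>p\<in>Q. p \<subseteq> T"
    unfolding pairable_def by (elim exE conjE)
  have "pairable \<T>"
  proof (rule pairableI)
    show "card p = 2" if "p \<in> P \<union> Q" for p using P Q that by blast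
    have "\<Union>P \<inter> \<Union>Q = {}" using P(3) Q(3) by blast
    then show "disjoint (P \<union> Q)" using P(2) Q(2) by (intro disjoint_union) auto
    show "\<exists>p\<in>P \<union> Q. p \<subseteq> T" if "T \<in> \<T>" for T
    proof (cases "T \<in> ?A")
      case True then show ?thesis using P(4) by blast
    next
      case False
      then have "T \<in> ?B" using neg that by blast
      then show ?thesis using Q(4) by blast
    qed
  qed
  then show False using not_pairable by blast
qed

text \<open>If no other triangle met \<open>u\<close> or \<open>v\<close>, a pairing of the
  remaining family could be extended by the pair \<open>{u, v}\<close>.\<close>

lemma not_private:
  assumes "T \<in> \<T>" "u \<in> T" "v \<in> T" "u \<noteq> v"
  shows "\<exists>T'\<in>\<T>. T' \<noteq> T \<and> (u \<in> T' \<or> v \<in> T')"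
proof (rule ccontr)
  assume neg: "\<not> ?thesis"
  let ?A = "\<T> - {T}"
  have "?A \<subset> \<T>" using assms by blast
  then have "pairable ?A" using minimal by blast
  then obtain P where P: "\<forall>p\<in>P. card p = 2" "disjoint P" "\<Union>P \<subseteq> \<Union>?A" "\<forall>T\<in>?A. \<exists>p\<in>P. p \<subseteq> T"
    unfolding pairable_def by (elim exE conjE)
  have "pairable \<T>"
  proof (rule pairableI)
    show "card p = 2" if "p \<in> insert {u, v} P" for p using P assms that by auto
    have "{u, v} \<inter> \<Union>P = {}" using P(3) neg by blast
    then show "disjoint (insert {u, v} P)" using P(2) by (auto simp: disjoint_def)
    show "\<exists>p\<in>insert {u, v} P. p \<subseteq> T'" if "T' \<in> \<T>" for T'
      using P(4) assms that by (cases "T' = T") auto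
  qed
  then show False using not_pairable by blast
qed

lemma nonempty: "\<T> \<noteq> {}"
proof
  assume "\<T> = {}"
  then have "pairable \<T>" by (intro pairableI[of "{}"]) (auto simp: disjoint_def)
  then show False using not_pairable by blast
qed

text \<open>A largest set reachable from \<open>A\<close> exists by the size bound; if it were not
  all of \<open>V\<close>, then \<open>connected\<close> would supply one more triangle to
  attach.\<close>

lemma reach_all:
  assumes "A \<subseteq> V" "A \<noteq> {}" "int (card A) + 2 * wt G A \<le> 21" "card A \<le> 23" "finite A"
  shows "reach \<T> A V"
proof -
  have b: "\<forall>S. reach \<T> A S \<longrightarrow> card S < 22"
    using reach_props[OF _ assms(5,3,4)] by force
  obtain S where S: "reach \<T> A S" "\<forall>S'. reach \<T> A S' \<longrightarrow> card S' \<le> card S"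
    using ex_has_greatest_nat[of "reach \<T> A" A card 22] reach.start b by metis
  have p: "finite S" "A \<subseteq> S" "S \<subseteq> V" using reach_props[OF S(1) assms(5,3,4)] assms(1) by auto
  have "V \<subseteq> S"
  proof (rule ccontr)
    assume "\<not> V \<subseteq> S"
    moreover have "S \<inter> V \<noteq> {}" using p assms by blast
    ultimately obtain T where T: "T \<in> \<T>" "T \<inter> S \<noteq> {}" "\<not> T \<subseteq> S" using connected by blast
    then have "reach \<T> A (S \<union> T)" using S(1) by (intro reach.attach)
    then have "card (S \<union> T) \<le> card S" using S(2) by blast
    moreover have "finite (S \<union> T)" using p T tri triangle_finite by blast
    ultimately have "S \<union> T = S" by (metis card_subset_eq card_mono le_antisym sup_ge1)
    then show False using T by blast
  qed
  then show ?thesis using S(1) p by (metis subset_antisym)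
qed

lemma wt_triangle:
  assumes "T \<in> \<T>" shows "wt G T \<le> 9"
proof -
  have T: "T \<in> triangles G" using assms tri by blast
  then have "card T = 3" by (simp add: triangles_def)
  then obtain a b c where abc: "T = {a, b, c}" "a \<noteq> b" "b \<noteq> c" "a \<noteq> c" by (auto simp: card_3_iff)
  have "card {{a, b}, {a, c}, {b, c}} = 3" using abc by (auto simp: doubleton_eq_iff)
  moreover have "{{a, b}, {a, c}, {b, c}} \<subseteq> {e \<in> G. e \<subseteq> T}" using triangle_edge[OF T] abc by auto
  ultimately have "3 \<le> card {e \<in> G. e \<subseteq> T}" using fin by (metis (no_types, lifting) card_mono finite_subset mem_Collect_eq subsetI)
  then show ?thesis using \<open>card T = 3\<close> by (simp add: wt_def)
qed

text \<open>A single triangle has 3 + 2 * 9 = 21, exactly the starting value that the exploration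
  allows.\<close>

lemma V_bounds: "finite V" "0 \<le> wt G V"
proof -
  obtain T where T: "T \<in> \<T>" using nonempty by blast
  then have "T \<in> triangles G" using tri by blast
  then have c: "card T = 3" "finite T" by (auto simp: triangles_def intro: card_ge_0_finite)
  then have "int (card T) + 2 * wt G T \<le> 21" using wt_triangle[OF T] by auto
  moreover from this have "reach \<T> T V" using T c by (intro reach_all) auto
  ultimately show "finite V" "0 \<le> wt G V" using reach_props[of T V] c by auto
qed

text \<open>If the triangles are edge-disjoint, then there are \<open>3 * card \<T>\<close> edges, but at most
  \<open>2 * card \<T>\<close> vertices since a triangle has at most one vertex of its own.\<close>
lemma ex_diamond: "\<exists>T\<in>\<T>. \<exists>T'\<in>\<T>. T \<noteq> T' \<and> (\<exists>x y. x \<noteq> y \<and> {x, y} \<subseteq> T \<inter> T')"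
proof (rule ccontr)
  assume neg: "\<not> ?thesis"
  have finT: "finite \<T>" using V_bounds(1) finite_UnionD by blast
  have c3: "card T = 3" "finite T" if "T \<in> \<T>" for T
    using subsetD[OF tri that] triangle_finite by (auto simp: triangles_def)
  define own where "own v T \<longleftrightarrow> (\<forall>T'\<in>\<T>. v \<in> T' \<longrightarrow> T' = T)" for v T
  let ?i = "\<lambda>b. if b then 1 else (0::nat)"
  \<comment> \<open>Double counting: a vertex in two triangles is counted twice, and a private one
    gets a second unit for being private. A triangle hands out at most 3 + 1 units.\<close>
  have two: "2 \<le> (\<Sum>T\<in>\<T>. ?i (v \<in> T) + ?i (v \<in> T \<and> own v T))" if v: "v \<in> V" for v
  proof -
    obtain T where T: "T \<in> \<T>" "v \<in> T" using v by blast
    show ?thesis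
    proof (cases "own v T")
      case True
      then have "2 = ?i (v \<in> T) + ?i (v \<in> T \<and> own v T)" using T by simp
      also have "\<dots> \<le> (\<Sum>T\<in>\<T>. ?i (v \<in> T) + ?i (v \<in> T \<and> own v T))"
        using T finT by (intro member_le_sum) auto
      finally show ?thesis .
    next
      case False
      then obtain T' where T': "T' \<in> \<T>" "v \<in> T'" "T' \<noteq> T" by (auto simp: own_def)
      have "2 \<le> (\<Sum>T\<in>{T, T'}. ?i (v \<in> T) + ?i (v \<in> T \<and> own v T))"
        using T T' by simp
      also have "\<dots> \<le> (\<Sum>T\<in>\<T>. ?i (v \<in> T) + ?i (v \<in> T \<and> own v T))"
        using T T' finT by (intro sum_mono2) auto
      finally show ?thesis .
    qed
  qed
  have "2 * card V = (\<Sum>v\<in>V. 2)" by simp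
  also have "\<dots> \<le> (\<Sum>v\<in>V. \<Sum>T\<in>\<T>. ?i (v \<in> T) + ?i (v \<in> T \<and> own v T))"
    by (rule sum_mono) (rule two)
  also have "\<dots> = (\<Sum>T\<in>\<T>. \<Sum>v\<in>V. ?i (v \<in> T) + ?i (v \<in> T \<and> own v T))"
    by (rule sum.swap)
  also have "\<dots> \<le> (\<Sum>T\<in>\<T>. 4)"
  proof (rule sum_mono)
    fix T assume T: "T \<in> \<T>"
    have "(\<Sum>v\<in>V. ?i (v \<in> T)) = card T"
      using T V_bounds(1) by (subst sum.inter_filter[symmetric]) (auto intro!: arg_cong[where f = card])
    moreover have "(\<Sum>v\<in>V. ?i (v \<in> T \<and> own v T)) = card {v \<in> T. own v T}"
      using T V_bounds(1) by (subst sum.inter_filter[symmetric]) (auto intro!: arg_cong[where f = card])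
    moreover have "card {v \<in> T. own v T} \<le> 1"
    proof -
      have "u = v" if "u \<in> T" "v \<in> T" "own u T" "own v T" for u v
        using not_private[OF T that(1,2)] that(3,4) by (auto simp: own_def)
      then show ?thesis using c3[OF T] by (auto simp: card_le_Suc0_iff_eq)
    qed
    ultimately show "(\<Sum>v\<in>V. ?i (v \<in> T) + ?i (v \<in> T \<and> own v T)) \<le> 4"
      using c3[OF T] by (simp add: sum.distrib)
  qed
  finally have vert: "card V \<le> 2 * card \<T>" by simp
  let ?E = "\<lambda>T. {e. e \<subseteq> T \<and> card e = 2}"
  have "card (\<Union>T\<in>\<T>. ?E T) = (\<Sum>T\<in>\<T>. card (?E T))"
  proof (rule card_UN_disjoint)
    show "\<forall>T\<in>\<T>. finite (?E T)" using c3 by auto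
    show "\<forall>T\<in>\<T>. \<forall>T'\<in>\<T>. T \<noteq> T' \<longrightarrow> ?E T \<inter> ?E T' = {}"
    proof (intro ballI impI equals0I)
      fix T T' e assume T: "T \<in> \<T>" "T' \<in> \<T>" "T \<noteq> T'" and e: "e \<in> ?E T \<inter> ?E T'"
      then obtain x y where "e = {x, y}" "x \<noteq> y" by (auto simp: card_2_iff)
      then have "x \<noteq> y \<and> {x, y} \<subseteq> T \<inter> T'" using e by blast
      then show False using neg T by blast
    qed
  qed (use finT in auto)
  also have "\<dots> = (\<Sum>T\<in>\<T>. 3)"
    using c3 by (intro sum.cong refl) (simp add: n_subsets numeral_3_eq_3 numeral_2_eq_2)
  finally have "card (\<Union>T\<in>\<T>. ?E T) = 3 * card \<T>" by simp
  moreover have "card (\<Union>T\<in>\<T>. ?E T) \<le> card {e \<in> G. e \<subseteq> V}"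
  proof (rule card_mono)
    show "(\<Union>T\<in>\<T>. ?E T) \<subseteq> {e \<in> G. e \<subseteq> V}"
    proof
      fix e assume "e \<in> (\<Union>T\<in>\<T>. ?E T)"
      then obtain T where T: "T \<in> \<T>" "e \<subseteq> T" "card e = 2" by blast
      moreover obtain x y where "e = {x, y}" "x \<noteq> y" using T(3) by (auto simp: card_2_iff)
      moreover have "T \<in> triangles G" using T tri by blast
      ultimately show "e \<in> {e \<in> G. e \<subseteq> V}" using triangle_edge by auto
    qed
  qed (use fin in auto)
  ultimately have "7 * (3 * card \<T>) \<le> 10 * card V"
    using V_bounds(2) by (simp add: wt_def)
  \<comment> \<open>Here
    \<open>21 * card \<T> \<le> 10 * card V \<le> 20 * card \<T>\<close>.\<close>
  with vert have "card \<T> = 0" by linarith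
  then show False using nonempty finT by simp
qed

lemma triangle_card: "T \<in> \<T> \<Longrightarrow> card T = 3"
  using tri by (auto simp: triangles_def)

lemma third_vertex:
  assumes "T \<in> \<T>" "a \<in> T" "b \<in> T" "a \<noteq> b"
  obtains c where "T = {a, b, c}" "c \<noteq> a" "c \<noteq> b"
proof -
  have "card (T - {a, b}) = 1"
    using assms triangle_card[OF assms(1)] by (subst card_Diff_subset) auto
  then obtain c where "T - {a, b} = {c}" by (auto simp: card_1_singleton_iff)
  then show thesis using that[of c] assms by blast
qed

lemma no_pair_cover:
  assumes "a \<noteq> b" shows "\<exists>T\<in>\<T>. \<not> {a, b} \<subseteq> T"
proof (rule ccontr)
  assume "\<not> ?thesis"
  then have "pairable \<T>" using assms by (intro pairableI[of "{{a, b}}"]) (auto simp: disjoint_def)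
  then show False using not_pairable by blast
qed

text \<open>One pair, or two disjoint ones, are the only pairings that \<open>ex_DD\<close> has to
  exhibit in order to exclude a configuration.\<close>

lemma no_two_pairs_cover:
  assumes "distinct [a, b, c, d]" shows "\<exists>T\<in>\<T>. \<not> {a, b} \<subseteq> T \<and> \<not> {c, d} \<subseteq> T"
proof (rule ccontr)
  assume "\<not> ?thesis"
  then have "pairable \<T>" using assms by (intro pairableI[of "{{a, b}, {c, d}}"]) (auto simp: disjoint_def)
  then show False using not_pairable by blast
qed

text \<open>The exploration from the diamond \<open>A\<close>, of weight at most 5, is undone from
  its last step. A last triangle with two new vertices costs 8, because \<open>not_private\<close>
  forces an extra edge. One glued along an edge costs 4, so at most one triangle, hanging at a
  vertex, came before it. This leaves \<open>A\<close> alone, \<open>A\<close> with a glued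
  triangle, and \<open>A\<close> with a hanging and a glued triangle.\<close>

lemma ex_DD:
  "\<exists>x y z1 z2 u v t. distinct [x, y, z1, z2, u, v, t] \<and>
     {{x, y}, {x, z1}, {x, z2}, {y, z1}, {y, z2}, {x, u}, {x, v}, {x, t}, {u, v}, {u, t}} \<subseteq> G"
proof -
  obtain T T' x y where TT: "T \<in> \<T>" "T' \<in> \<T>" "T \<noteq> T'" "x \<noteq> y" "x \<in> T" "y \<in> T" "x \<in> T'" "y \<in> T'"
    using ex_diamond by auto
  obtain z1 where z1: "T = {x, y, z1}" "z1 \<noteq> x" "z1 \<noteq> y" using third_vertex TT by metis
  obtain z2 where z2: "T' = {x, y, z2}" "z2 \<noteq> x" "z2 \<noteq> y" using third_vertex TT by metis
  have "z1 \<noteq> z2" using TT z1 z2 by blast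
  have tG: "T \<in> triangles G" "T' \<in> triangles G" using TT tri by auto
  have e: "{x, y} \<in> G" "{x, z1} \<in> G" "{y, z1} \<in> G" "{x, z2} \<in> G" "{y, z2} \<in> G"
    using triangle_edge[OF tG(1)] triangle_edge[OF tG(2)] z1 z2 TT by auto
  define A where "A = {x, y, z1, z2}"
  have A: "card A = 4" "finite A" "A \<noteq> {}"
    using TT(4) z1(2,3) z2(2,3) \<open>z1 \<noteq> z2\<close> by (simp_all add: A_def)
  have AV: "A \<subseteq> V" using TT(1,2) z1(1) z2(1) unfolding A_def by blast
  let ?F = "{{x, y}, {x, z1}, {y, z1}, {x, z2}, {y, z2}}"
  have F: "card ?F = 5" "card (insert {z1, z2} ?F) = 6"
    using TT(4) z1(2,3) z2(2,3) \<open>z1 \<noteq> z2\<close> by (simp_all add: doubleton_eq_iff)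
  have "card ?F \<le> card {e \<in> G. e \<subseteq> A}"
    using fin e by (intro card_mono) (auto simp: A_def)
  \<comment> \<open>The value is 40 - 35; the sixth edge \<open>{z1, z2}\<close> would make it 40 -
    42.\<close>
  then have wtA: "wt G A \<le> 5" using A F by (simp add: wt_def)
  have zz: "{z1, z2} \<notin> G"
  proof
    assume "{z1, z2} \<in> G"
    then have "card (insert {z1, z2} ?F) \<le> card {e \<in> G. e \<subseteq> A}"
      using fin e by (intro card_mono) (auto simp: A_def)
    then have "wt G A < 0" using A F by (simp add: wt_def)
    then show False using sparseD[OF sparse, of A] A by simp
  qed
  have in_A: "T0 = {x, y, z1} \<or> T0 = {x, y, z2}" if T0: "T0 \<in> \<T>" "T0 \<subseteq> A" for T0
  proof -
    have "\<not> {z1, z2} \<subseteq> T0"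
      using triangle_edge[of T0 G z1 z2] zz tri that \<open>z1 \<noteq> z2\<close> by auto
    then obtain z where z: "z \<in> {z1, z2}" "T0 \<subseteq> {x, y, z}" using T0(2) unfolding A_def by blast
    moreover have "card {x, y, z} = 3" using z TT(4) z1 z2 by auto
    ultimately have "T0 = {x, y, z}" using triangle_card[OF that(1)] by (intro card_subset_eq) auto
    then show ?thesis using z by auto
  qed
  have Abd: "int (card A) + 2 * wt G A \<le> 21" "card A \<le> 23" using A wtA by auto
  have "reach \<T> A V" using reach_all A AV Abd by blast
  then show ?thesis
  proof (cases rule: reach.cases)
    case start
    \<comment> \<open>With \<open>V = A\<close>, the pair \<open>{x, y}\<close> lies in both
      triangles.\<close>
    then show ?thesis using no_pair_cover[OF TT(4)] in_A by blast
  next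
    case (attach S T)
    note S = reach_props[OF attach(2) A(2) Abd]
    have wtV: "0 \<le> wt G (S \<union> T)" using V_bounds(2) attach(1) by simp
    have "T \<in> triangles G" using attach tri by blast
    from this attach(4,5) show ?thesis
    proof (cases rule: attach_cases)
      case (two u v s)
      \<comment> \<open>A second triangle at \<open>u\<close> or \<open>v\<close> has a vertex
        \<open>a\<close> outside \<open>T\<close>, which is in \<open>S\<close> since
        \<open>T\<close> came last. This gives the extra edge, and 5 - 8 is negative.\<close>
      obtain T' where T': "T' \<in> \<T>" "T' \<noteq> T" "u \<in> T' \<or> v \<in> T'"
        using not_private[of T u v] attach(3) two by auto
      have "\<not> T' \<subseteq> T"
        using T' attach(3) triangle_card card_subset_eq[of T T'] triangle_finite[OF \<open>T \<in> triangles G\<close>] by auto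
      then obtain a where a: "a \<in> T'" "a \<notin> T" by blast
      have "a \<in> S" using a T'(1) attach(1) by blast
      moreover have "{u, a} \<in> G \<or> {v, a} \<in> G"
        using triangle_edge[of T' G] T' tri a two by blast
      ultimately have "wt G (S \<union> T) \<le> wt G S - 8"
        using wt_two_new(2)[of G S u v s a] two fin S a by auto
      then have False using wtV S wtA by auto
      then show ?thesis ..
    next
      case (one t p q)
      \<comment> \<open>The weight stays nonnegative after a loss of 4, and a third edge at
        \<open>t\<close> would make the loss 11. Hence \<open>T\<close> is the only triangle at
        \<open>t\<close>.\<close>
      have wtS: "4 \<le> wt G S" using wt_one_new(1)[of G S t p q] one fin S wtV by auto
      have nbr_t: "a \<in> {p, q}" if "a \<in> S" "{t, a} \<in> G" for a
        using wt_one_new(2)[of G S t p q a] one fin S wtV wtA that by fastforce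
      have T0_cases: "T0 = {t, p, q} \<or> T0 \<subseteq> S" if "T0 \<in> \<T>" for T0
      proof (cases "t \<in> T0")
        case True
        have "T0 \<subseteq> {t, p, q}"
        proof
          fix a assume a: "a \<in> T0"
          then have "a \<in> insert t S" using that attach(1) one by blast
          then show "a \<in> {t, p, q}"
            using nbr_t[of a] triangle_edge[of T0 G t a] that tri True a by auto
        qed
        then have "T0 = {t, p, q}"
          using that attach(3) one(1) triangle_card by (metis card_subset_eq finite.emptyI finite_insert)
        then show ?thesis by blast
      next
        case False
        then show ?thesis using that attach(1) one by blast
      qed
      from attach(2) show ?thesis
      proof (cases rule: reach.cases)
        case start
        show ?thesis
        proof (cases "{p, q} = {x, y}")
          case True
          then have "{x, y} \<subseteq> T0" if "T0 \<in> \<T>" for T0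
            using T0_cases[OF that] in_A[OF that] start by auto
          then show ?thesis using no_pair_cover[OF TT(4)] by blast
        next
          case False
          have "{p, q} \<noteq> {z1, z2}" using one zz by auto
          \<comment> \<open>\<open>T\<close> is glued to an outer edge \<open>{a, z}\<close> of the
            diamond. This pair serves \<open>T\<close> and the triangle through \<open>z\<close>;
            the opposite pair \<open>{a', z'}\<close> serves the other triangle.\<close>
          then obtain a a' z z' where az: "{p, q} = {a, z}" "{a, a'} = {x, y}" "{z, z'} = {z1, z2}"
            using False one(3,4,5) start unfolding A_def by (auto simp: doubleton_eq_iff)
          have "distinct [a, z, a', z']"
            using az(2,3) TT(4) z1 z2 \<open>z1 \<noteq> z2\<close> by (auto simp: doubleton_eq_iff)
          then obtain T0 where T0: "T0 \<in> \<T>" "\<not> {a, z} \<subseteq> T0" "\<not> {a', z'} \<subseteq> T0"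
            using no_two_pairs_cover by blast
          then show ?thesis
            using T0_cases[OF T0(1)] in_A[OF T0(1)] az start by (auto simp: doubleton_eq_iff)
        qed
      next
        case (attach S' T1)
        note S' = reach_props[OF attach(2) A(2) Abd]
        have T1: "T1 \<in> triangles G" using attach tri by blast
        from this attach(4,5) show ?thesis
        proof (cases rule: attach_cases)
          case (one t p q)
          \<comment> \<open>At most 5 - 4 = 1 would be left, too little for attaching
            \<open>T\<close>.\<close>
          then have "wt G S \<le> wt G S' - 4" using wt_one_new(1)[of G S' t p q] fin S' attach(1) by auto
          then have False using wtS S' wtA by auto
          then show ?thesis ..
        next
          case (two u v s)
          have "wt G S \<le> wt G S' - 1" using two wt_two_new(1)[of G S' u v s] fin S' attach(1) by auto
          \<comment> \<open>Weight at least 5 is required before \<open>T1\<close>, and any earlier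
            attachment would have reduced it to at most 4.\<close>
          then have SA: "S' = A" using wtS S' wtA by auto
          have S_eq: "S = insert u (insert v A)" using attach(1) two SA by simp
          \<comment> \<open>A further edge from \<open>u\<close> or \<open>v\<close> to
            \<open>A\<close> would cost 8 instead of 1, so \<open>T1\<close> is the only triangle
            within \<open>S\<close> at \<open>u\<close> or \<open>v\<close>.\<close>
          have nbr_uv: "a = s" if "a \<in> A" "{u, a} \<in> G \<or> {v, a} \<in> G" for a
            using wt_two_new(2)[of G A u v s a] two(2-5,7-9) fin A that wtS wtA unfolding S_eq SA by fastforce
          have uvT: "T0 = {u, v, s}" if "T0 \<in> \<T>" "T0 \<subseteq> S" "u \<in> T0 \<or> v \<in> T0" for T0
          proof -
            have "T0 \<subseteq> {u, v, s}"
            proof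
              fix a assume a: "a \<in> T0"
              then have "a \<in> insert u (insert v A)" using that S_eq by blast
              then show "a \<in> {u, v, s}"
                using nbr_uv[of a] triangle_edge[of T0 G _ a] that tri a by auto
            qed
            then show ?thesis
              using that(1) attach(3) two(1) triangle_card by (metis card_subset_eq finite.emptyI finite_insert)
          qed
          have T0_cases2: "T0 = {t, p, q} \<or> T0 = {u, v, s} \<or> T0 = {x, y, z1} \<or> T0 = {x, y, z2}"
            if T0: "T0 \<in> \<T>" for T0
          proof -
            consider "T0 = {t, p, q}" | "T0 \<subseteq> S" "u \<in> T0 \<or> v \<in> T0" | "T0 \<subseteq> A"
              using T0_cases[OF T0] S_eq by blast
            then show ?thesis using uvT[OF T0] in_A[OF T0] by cases simp_all
          qed
          have sA: "s \<in> A" "u \<notin> A" "v \<notin> A" using two SA by auto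
          \<comment> \<open>\<open>T\<close> and \<open>T1\<close> form a second diamond with common
            edge \<open>{a, s}\<close>. If \<open>s\<close> is one of \<open>z1\<close>,
            \<open>z2\<close>, the pairs \<open>{x, y}\<close> and \<open>{a, s}\<close> cover
            everything. Otherwise \<open>s\<close> lies on the common edge of both diamonds and is
            the centre of a double diamond.\<close>
          have end_case: ?thesis if pq: "{p, q} = {a, s}" and uv: "{a, a'} = {u, v}" for a a'
          proof -
            have t: "t \<notin> A" "t \<noteq> a" "t \<noteq> a'" using one(2) uv S_eq by auto
            have aa: "a \<notin> A" "a' \<notin> A" "a \<noteq> a'" using uv sA two(4) by (auto simp: doubleton_eq_iff)
            have ea: "{s, a} \<in> G" "{s, a'} \<in> G" "{a, a'} \<in> G"
              using uv two(7,8,9) by (auto simp: doubleton_eq_iff insert_commute)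
            have et: "{s, t} \<in> G" "{a, t} \<in> G"
              using pq one(7,8) by (auto simp: doubleton_eq_iff insert_commute)
            show ?thesis
            proof (cases "s \<in> {z1, z2}")
              case True
              then have "distinct [x, y, a, s]" using TT(4) aa z1 z2 by (auto simp: A_def)
              then obtain T0 where T0: "T0 \<in> \<T>" "\<not> {x, y} \<subseteq> T0" "\<not> {a, s} \<subseteq> T0"
                using no_two_pairs_cover by blast
              then have "T0 = {t, p, q} \<or> T0 = {u, v, s}" using T0_cases2[OF T0(1)] by blast
              then show ?thesis using T0(3) pq uv by blast
            next
              case False
              then obtain y' where y': "{s, y'} = {x, y}" using sA(1) by (auto simp: A_def)
              have "distinct [s, y', z1, z2, a, a', t]"
                using y' z1(2,3) z2(2,3) \<open>z1 \<noteq> z2\<close> TT(4) aa t unfolding A_def doubleton_eq_iff by auto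
              moreover have "{s, y'} \<in> G" "{s, z1} \<in> G" "{s, z2} \<in> G" "{y', z1} \<in> G" "{y', z2} \<in> G"
                using y' e unfolding doubleton_eq_iff by (auto simp: insert_commute)
              ultimately have "distinct [s, y', z1, z2, a, a', t] \<and> {{s, y'}, {s, z1}, {s, z2}, {y', z1}, {y', z2},
                  {s, a}, {s, a'}, {s, t}, {a, a'}, {a, t}} \<subseteq> G"
                using ea et by simp
              then show ?thesis by (intro exI)
            qed
          qed
          consider "p \<in> A" "q \<in> A" | "{p, q} = {u, v}" | "{p, q} = {u, s}" | "{p, q} = {v, s}"
            using one(3,4,5,9) nbr_uv[of p] nbr_uv[of q] unfolding S_eq by (auto simp: insert_commute)
          then show ?thesis
          proof cases
            \<comment> \<open>If \<open>T\<close> is glued to an edge inside \<open>A\<close>, then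
              \<open>u\<close> and \<open>v\<close> are both private to \<open>T1\<close>.\<close>
            case 1
            obtain T' where T': "T' \<in> \<T>" "T' \<noteq> T1" "u \<in> T' \<or> v \<in> T'"
              using not_private[of T1 u v] attach(3) two by auto
            then have "T' = {t, p, q}" using T0_cases uvT two(1) by blast
            then show ?thesis using T'(3) 1 sA one(2) S_eq by auto
          next
            case 2
            \<comment> \<open>The pair \<open>{u, v}\<close> serves \<open>T\<close> and
              \<open>T1\<close>, the pair \<open>{x, y}\<close> the two triangles of
              \<open>A\<close>.\<close>
            have "distinct [x, y, u, v]" using TT(4) sA two(4) by (auto simp: A_def)
            then show ?thesis using no_two_pairs_cover T0_cases2 2 by blast
          next
            case 3
            then show ?thesis using end_case[of u v] by simp
          next
            case 4
            then show ?thesis using end_case[of v u] by (simp add: insert_commute)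
          qed
        qed
      qed
    qed
  qed
qed

end

section \<open>Double diamonds\<close>

abbreviation DD_copy :: "(nat \<Rightarrow> 'a) \<Rightarrow> 'a set set" where
  "DD_copy f \<equiv> (\<lambda>e. f ` e) ` DD_edges"

text \<open>An unpairable subfamily of least cardinality is minimal under inclusion, so
  \<open>ex_DD\<close> would yield a double diamond.\<close>

lemma sparse_no_DD_pairable:
  fixes G :: "nat set set"
  assumes "finite G" "finite (\<Union>G)" "sparse G" "DD_copies G = {}"
  shows "pairable (triangles G)"
proof (rule ccontr)
  assume np: "\<not> pairable (triangles G)"
  have "T \<subseteq> \<Union>G" if "T \<in> triangles G" for T
  proof
    fix v assume "v \<in> T"
    have "card T = 3" using that by (simp add: triangles_def)
    then have "\<not> T \<subseteq> {v}" using card_mono[of "{v}" T] by auto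
    then obtain u where "u \<in> T" "u \<noteq> v" by blast
    then show "v \<in> \<Union>G" using triangle_edge[OF that \<open>v \<in> T\<close>, of u] by auto
  qed
  then have fin: "finite (triangles G)"
    using assms(2) by (auto intro: finite_subset[of _ "Pow (\<Union>G)"])
  let ?Q = "\<lambda>\<T>. \<T> \<subseteq> triangles G \<and> \<not> pairable \<T>"
  obtain \<T> where T: "?Q \<T>" "\<And>\<S>. ?Q \<S> \<Longrightarrow> card \<T> \<le> card \<S>"
    using ex_has_least_nat[of ?Q "triangles G" card] np by auto
  have "pairable \<S>" if "\<S> \<subset> \<T>" for \<S>
  proof (rule ccontr)
    assume "\<not> pairable \<S>"
    then have "card \<T> \<le> card \<S>" using T that by blast
    moreover have "finite \<T>" using T fin finite_subset by blast
    ultimately show False using psubset_card_mono[OF _ that] by simp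
  qed
  then interpret minimal_family G \<T>
    using assms T by unfold_locales auto
  obtain x y z1 z2 u v t where d: "distinct [x, y, z1, z2, u, v, t]" and
     e: "{{x, y}, {x, z1}, {x, z2}, {y, z1}, {y, z2}, {x, u}, {x, v}, {x, t}, {u, v}, {u, t}} \<subseteq> G"
    using ex_DD by (elim exE conjE)
  \<comment> \<open>The list follows the vertex numbering of \<open>DD_edges\<close>, with the
    centre at 0.\<close>
  define f where "f i = [x, y, z1, z2, u, v, t] ! i" for i
  have "inj_on ((!) [x, y, z1, z2, u, v, t]) {0..<7}" using d by (intro inj_on_nth) auto
  then have "inj_on f {0..<7}" by (simp add: f_def[abs_def])
  moreover have "DD_copy f \<subseteq> G" using e by (simp add: DD_edges_def f_def)
  ultimately show False using assms(4) by (auto simp: DD_copies_def)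
qed

section \<open>Balancedness and disjointness of double diamonds\<close>

lemma DD_vertices: "{0..<7::nat} = {0, 1, 2, 3, 4, 5, 6}"
  by auto

lemma Union_DD_edges: "\<Union>DD_edges = {0..<7}"
  by (auto simp: DD_edges_def)

lemma finite_DD_edges: "finite DD_edges"
  by (simp add: DD_edges_def)

lemma card_DD_edges: "card DD_edges = 10"
  by (simp add: DD_edges_def doubleton_eq_iff)

text \<open>Strict balancedness of the double diamond, whose density is 10/7. It is checked on all
  128 vertex subsets.\<close>

lemma DD_balanced:
  assumes "J \<subseteq> {0..<7}"
  shows "7 * card {e \<in> DD_edges. e \<subseteq> J} \<le> 10 * card J"
    and "card J \<noteq> 0 \<Longrightarrow> card J \<noteq> 7 \<Longrightarrow> 7 * card {e \<in> DD_edges. e \<subseteq> J} < 10 * card J"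
proof -
  have "card J = card {i \<in> {0..<7}. i \<in> J}" using assms by (intro arg_cong[where f = card]) auto
  also have "\<dots> = (\<Sum>i\<in>{0..<7}. if i \<in> J then 1 else 0)"
    by (simp add: sum.If_cases Int_def)
  \<comment> \<open>Both cardinalities become sums of indicators, which the seven membership splits
    evaluate.\<close>
  finally have J: "card J = (\<Sum>i\<in>{0, 1, 2, 3, 4, 5, 6}. if i \<in> J then 1 else 0)"
    by (simp only: DD_vertices)
  have "card {e \<in> DD_edges. e \<subseteq> J} = (\<Sum>e\<in>DD_edges. if e \<subseteq> J then 1 else 0)"
    using finite_DD_edges by (simp add: sum.If_cases Int_def)
  then have E: "card {e \<in> DD_edges. e \<subseteq> J} =
     (\<Sum>(i, j)\<in>{(0,1),(0,2),(0,3),(1,2),(1,3),(0,4),(0,5),(0,6),(4,5),(4,6)}. if i \<in> J \<and> j \<in> J then 1 else 0)"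
    by (simp add: DD_edges_def doubleton_eq_iff)
  show "7 * card {e \<in> DD_edges. e \<subseteq> J} \<le> 10 * card J"
    unfolding J E
    by (cases "0 \<in> J"; cases "1 \<in> J"; cases "2 \<in> J"; cases "3 \<in> J"; cases "4 \<in> J"; cases "5 \<in> J"; cases "6 \<in> J") simp_all
  show "7 * card {e \<in> DD_edges. e \<subseteq> J} < 10 * card J" if "card J \<noteq> 0" "card J \<noteq> 7"
    using that unfolding J E
    by (cases "0 \<in> J"; cases "1 \<in> J"; cases "2 \<in> J"; cases "3 \<in> J"; cases "4 \<in> J"; cases "5 \<in> J"; cases "6 \<in> J") simp_all
qed

lemma inj_on_image_DD:
  assumes "inj_on f {0..<7}" shows "inj_on (\<lambda>e. f ` e) DD_edges"
  using inj_on_image[of f DD_edges] assms by (simp add: Union_DD_edges)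

lemma card_DD_copy:
  assumes "inj_on f {0..<7}" shows "card (DD_copy f) = 10"
  using card_image[OF inj_on_image_DD[OF assms]] card_DD_edges by simp

lemma Union_DD_copy: "\<Union>(DD_copy f) = f ` {0..<7}"
  using Union_DD_edges by (metis image_Union)

text \<open>Common edges only use common vertices, so their preimages under \<open>f\<close> are
  edges of the double diamond inside \<open>J\<close>, and \<open>DD_balanced\<close>
  applies.\<close>

lemma DD_copy_inter:
  fixes f g :: "nat \<Rightarrow> 'a"
  assumes f: "inj_on f {0..<7}"
  defines "I \<equiv> f ` {0..<7} \<inter> g ` {0..<7}"
  shows "7 * card (DD_copy f \<inter> DD_copy g) \<le> 10 * card I"
    and "card I \<noteq> 0 \<Longrightarrow> card I \<noteq> 7 \<Longrightarrow> 7 * card (DD_copy f \<inter> DD_copy g) < 10 * card I"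
proof -
  define J where "J = {i \<in> {0..<7}. f i \<in> g ` {0..<7}}"
  have J: "J \<subseteq> {0..<7}" by (auto simp: J_def)
  have "f ` J = I" by (auto simp: I_def J_def)
  then have "card I = card J" using card_image inj_on_subset[OF f J] by metis
  moreover have "card (DD_copy f \<inter> DD_copy g) \<le> card {e \<in> DD_edges. e \<subseteq> J}"
  proof (rule surj_card_le)
    show "finite {e \<in> DD_edges. e \<subseteq> J}" using finite_DD_edges by simp
    show "DD_copy f \<inter> DD_copy g \<subseteq> (\<lambda>e. f ` e) ` {e \<in> DD_edges. e \<subseteq> J}"
    proof
      fix c assume c: "c \<in> DD_copy f \<inter> DD_copy g"
      then obtain e where e: "e \<in> DD_edges" "c = f ` e" by blast
      have "c \<subseteq> g ` {0..<7}" using c Union_DD_copy[of g] by blast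
      moreover have "e \<subseteq> {0..<7}" using e(1) Union_DD_edges by blast
      ultimately have "e \<subseteq> J" using e(2) by (auto simp: J_def)
      then show "c \<in> (\<lambda>e. f ` e) ` {e \<in> DD_edges. e \<subseteq> J}" using e by blast
    qed
  qed
  ultimately show "7 * card (DD_copy f \<inter> DD_copy g) \<le> 10 * card I"
    and "card I \<noteq> 0 \<Longrightarrow> card I \<noteq> 7 \<Longrightarrow> 7 * card (DD_copy f \<inter> DD_copy g) < 10 * card I"
    using DD_balanced[OF J] by auto
qed

text \<open>The union has \<open>14 - card ?I\<close> vertices and \<open>20 - card ?C\<close>
  edges, so its weight is \<open>7 * card ?C - 10 * card ?I\<close>, which is negative as soon as
  the copies meet.\<close>

lemma sparse_DD_disjoint:
  assumes "finite E" "sparse E" and f: "inj_on f {0..<7}" "DD_copy f \<subseteq> E"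
    and g: "inj_on g {0..<7}" "DD_copy g \<subseteq> E" and neq: "DD_copy f \<noteq> DD_copy g"
  shows "f ` {0..<7} \<inter> g ` {0..<7} = {}"
proof (rule ccontr)
  let ?I = "f ` {0..<7} \<inter> g ` {0..<7}" and ?C = "DD_copy f \<inter> DD_copy g"
  let ?S = "f ` {0..<7} \<union> g ` {0..<7}"
  assume "?I \<noteq> {}"
  then have I: "card ?I \<noteq> 0" by simp
  have c: "card (f ` {0..<7}) = 7" "card (g ` {0..<7}) = 7" using f g by (auto simp: card_image)
  have "card ?C < 10"
  proof -
    have "?C \<noteq> DD_copy f"
      using neq card_DD_copy[OF f(1)] card_DD_copy[OF g(1)] finite_DD_edges
      by (metis card_subset_eq finite_imageI inf.absorb_iff1)
    then have "?C \<subset> DD_copy f" by blast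
    then show ?thesis
      using psubset_card_mono[of "DD_copy f" ?C] card_DD_copy[OF f(1)] finite_DD_edges by simp
  qed
  \<comment> \<open>If all seven vertices are shared, strictness comes from the copies being
    distinct: at most 9 common edges.\<close>
  then have lt: "7 * card ?C < 10 * card ?I"
    using DD_copy_inter(2)[OF f(1) I] by (cases "card ?I = 7") auto
  have S: "card ?S + card ?I = 14" using card_Un_Int[of "f ` {0..<7}" "g ` {0..<7}"] c by simp
  have "card (DD_copy f \<union> DD_copy g) + card ?C = 20"
    using card_Un_Int[of "DD_copy f" "DD_copy g"] card_DD_copy[OF f(1)] card_DD_copy[OF g(1)] finite_DD_edges by simp
  moreover have "card (DD_copy f \<union> DD_copy g) \<le> card {e \<in> E. e \<subseteq> ?S}"
    unfolding Union_DD_copy[symmetric] using assms(1) f(2) g(2) by (intro card_mono) auto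
  ultimately have "wt E ?S < 0" using S lt by (simp add: wt_def)
  moreover have "0 \<le> wt E ?S" using S by (intro sparseD[OF assms(2)]) auto
  ultimately show False by simp
qed

lemma Kn_edges_subset: "Kn_edges n \<subseteq> Pow {0..<n}"
  by (auto simp: Kn_edges_def)

lemma DD_copy_vertices:
  assumes "DD_copy f \<subseteq> Kn_edges n" shows "f ` {0..<7} \<subseteq> {0..<n}"
proof -
  have "\<Union>(DD_copy f) \<subseteq> \<Union>(Pow {0..<n})"
    using assms Kn_edges_subset by (intro Union_mono) (rule order_trans)
  then show ?thesis by (simp only: Union_DD_copy Union_Pow_eq)
qed

lemma finite_DD_copies: "finite E \<Longrightarrow> finite (DD_copies E)"
  by (rule finite_subset[of _ "Pow E"]) (auto simp: DD_copies_def)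

section \<open>The two games on a sparse graph\<close>

context
  fixes n :: nat and E :: "nat set set"
  assumes E: "E \<subseteq> Kn_edges n" and sparse: "sparse E"
begin

lemma finE: "finite E" and UE: "\<Union>E \<subseteq> {0..<n}"
  using E Kn_edges_subset[of n] by (auto intro: finite_subset[of _ "Pow {0..<n}"])

lemma maker_first_win_iff: "maker_first_win n E \<longleftrightarrow> has_k_DD 1 E"
proof
  assume "has_k_DD 1 E"
  then have "DD_copies E \<noteq> {}" by (auto simp: has_k_DD_def)
  then obtain f where f: "inj_on f {0..<7}" "DD_copy f \<subseteq> E" by (auto simp: DD_copies_def)
  then show "maker_first_win n E"
    unfolding maker_first_win_def using DD_copy_vertices[of f n] E by (intro maker_wins_DD) auto
next
  assume win: "maker_first_win n E"
  show "has_k_DD 1 E"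
  proof (rule ccontr)
    assume "\<not> has_k_DD 1 E"
    then have "DD_copies E = {}" using finite_DD_copies[OF finE] by (simp add: has_k_DD_def not_less_eq_eq)
    then have "pairable (triangles E)"
      using finE sparse finite_subset[OF UE] by (intro sparse_no_DD_pairable) auto
    then show False using pairing_strategy[of E "{}" "{0..<n}"] UE win by (simp add: maker_first_win_def)
  qed
qed

text \<open>Breaker's opening move hits at most one of two disjoint copies. If there is at most one
  copy, he opens at its centre and what remains has a pairing.\<close>

lemma maker_second_win_iff:
  assumes "0 < n"
  shows "maker_second_win n E \<longleftrightarrow> has_k_DD 2 E"
proof
  assume "has_k_DD 2 E"
  then have "\<not> card (DD_copies E) \<le> Suc 0" by (simp add: has_k_DD_def)
  then obtain C D where CD: "C \<in> DD_copies E" "D \<in> DD_copies E" "C \<noteq> D"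
    using finite_DD_copies[OF finE] by (auto simp: card_le_Suc0_iff_eq)
  obtain f where f: "inj_on f {0..<7}" "DD_copy f \<subseteq> E" "C = DD_copy f"
    using CD(1) unfolding DD_copies_def by auto
  obtain g where g: "inj_on g {0..<7}" "DD_copy g \<subseteq> E" "D = DD_copy g"
    using CD(2) unfolding DD_copies_def by auto
  have neq: "DD_copy f \<noteq> DD_copy g" using CD(3) f(3) g(3) by simp
  have dis: "f ` {0..<7} \<inter> g ` {0..<7} = {}"
    using sparse_DD_disjoint[OF finE sparse f(1,2) g(1,2) neq] .
  have V: "f ` {0..<7} \<subseteq> {0..<n}" "g ` {0..<7} \<subseteq> {0..<n}"
    using DD_copy_vertices[OF order_trans[OF f(2) E]] DD_copy_vertices[OF order_trans[OF g(2) E]] .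
  show "maker_second_win n E"
    unfolding maker_second_win_def
  proof (rule moveB)
    show "{0..<n} - {} - {} \<noteq> {}" using assms by auto
    show "\<forall>v\<in>{0..<n} - {} - {}. mwin_M {0..<n} E {} (insert v {})"
    proof
      fix v
      show "mwin_M {0..<n} E {} (insert v {})"
      proof (cases "v \<in> f ` {0..<7}")
        case True
        then have "v \<notin> g ` {0..<7}" using dis by blast
        then show ?thesis using V g(1,2) by (intro maker_wins_DD[of g]) auto
      next
        case False
        then show ?thesis using V f(1,2) by (intro maker_wins_DD[of f]) auto
      qed
    qed
  qed
next
  assume win: "maker_second_win n E"
  show "has_k_DD 2 E"
  proof (rule ccontr)
    assume "\<not> has_k_DD 2 E"
    then have "card (DD_copies E) \<le> Suc 0" by (simp add: has_k_DD_def)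
    then have uniq: "C = D" if "C \<in> DD_copies E" "D \<in> DD_copies E" for C D
      using finite_DD_copies[OF finE] that by (auto simp: card_le_Suc0_iff_eq)
    \<comment> \<open>Without any copy the opening move is 0 by default, which is on the board as
      \<open>0 < n\<close>.\<close>
    obtain x where x: "x < n" "\<And>C. C \<in> DD_copies E \<Longrightarrow> x \<in> \<Union>C"
    proof (cases "DD_copies E = {}")
      case True
      then show ?thesis using that[of 0] assms by auto
    next
      case False
      then obtain f where f: "inj_on f {0..<7}" "DD_copy f \<subseteq> E" by (auto simp: DD_copies_def)
      then have C: "DD_copy f \<in> DD_copies E" by (auto simp: DD_copies_def)
      have "f 0 \<in> \<Union>C" if "C \<in> DD_copies E" for C
        unfolding uniq[OF that C] Union_DD_copy by simp
      moreover have "f 0 < n"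
        using subsetD[OF DD_copy_vertices[OF order_trans[OF f(2) E]], of "f 0"] by simp
      ultimately show ?thesis using that by blast
    qed
    let ?G = "{e \<in> E. e \<inter> {x} = {}}"
    have "C \<in> DD_copies E \<and> x \<notin> \<Union>C" if "C \<in> DD_copies ?G" for C
      using that unfolding DD_copies_def by auto
    then have "DD_copies ?G = {}" using x(2) by blast
    moreover have "sparse ?G" by (rule sparse_subset[OF sparse _ finE]) auto
    moreover have "finite (\<Union>?G)" by (rule finite_subset[of _ "{0..<n}"]) (use UE in auto)
    ultimately have "pairable (triangles ?G)"
      using finE by (intro sparse_no_DD_pairable) auto
    then have lose: "\<not> mwin_M {0..<n} E {} {x}" using pairing_strategy[of E "{x}" "{0..<n}"] UE by simp
    from win show False
      unfolding maker_second_win_def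
    proof (cases rule: mwin_B.cases)
      case triB
      then show False by (auto simp: has_triangle_def)
    next
      case moveB
      then show False using lose x(1) by auto
    qed
  qed
qed

end

section \<open>Uniformly random sets of edges\<close>

definition nsets :: "'a set \<Rightarrow> nat \<Rightarrow> 'a set set" where
  "nsets A N = {U. U \<subseteq> A \<and> card U = N}"

lemma finite_nsets: "finite A \<Longrightarrow> finite (nsets A N)"
  by (rule finite_subset[of _ "Pow A"]) (auto simp: nsets_def)

lemma card_nsets: "finite A \<Longrightarrow> card (nsets A N) = card A choose N"
  unfolding nsets_def by (rule n_subsets)

lemma card_permutations_prefix:
  assumes "finite A" "U \<in> nsets A N"
  shows "card {es \<in> permutations_of_set A. set (take N es) = U} = fact N * fact (card A - N)"
proof -
  have U: "U \<subseteq> A" "card U = N" "finite U" using assms by (auto simp: nsets_def intro: finite_subset)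
  have "bij_betw (\<lambda>(xs, ys). xs @ ys) (permutations_of_set U \<times> permutations_of_set (A - U))
     {es \<in> permutations_of_set A. set (take N es) = U}"
  proof (rule bij_betw_byWitness[where f' = "\<lambda>es. (take N es, drop N es)"])
    have len: "length xs = N" if "xs \<in> permutations_of_set U" for xs
      using that U distinct_card by (fastforce simp: permutations_of_set_def)
    then show "\<forall>a\<in>permutations_of_set U \<times> permutations_of_set (A - U).
        (take N (case a of (xs, ys) \<Rightarrow> xs @ ys), drop N (case a of (xs, ys) \<Rightarrow> xs @ ys)) = a"
      by auto
    show "\<forall>a'\<in>{es \<in> permutations_of_set A. set (take N es) = U}.
        (case (take N a', drop N a') of (xs, ys) \<Rightarrow> xs @ ys) = a'"
      by auto
    show "(\<lambda>(xs, ys). xs @ ys) ` (permutations_of_set U \<times> permutations_of_set (A - U))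
        \<subseteq> {es \<in> permutations_of_set A. set (take N es) = U}"
      using U len by (auto simp: permutations_of_set_def)
    show "(\<lambda>es. (take N es, drop N es)) ` {es \<in> permutations_of_set A. set (take N es) = U}
        \<subseteq> permutations_of_set U \<times> permutations_of_set (A - U)"
    proof clarify
      fix es assume es: "es \<in> permutations_of_set A" "U = set (take N es)"
      then have d: "distinct (take N es @ drop N es)" "set (take N es @ drop N es) = A"
        by (auto simp: permutations_of_set_def)
      then have "set (drop N es) = A - set (take N es)"
        unfolding set_append distinct_append by blast
      then show "take N es \<in> permutations_of_set (set (take N es)) \<and>
          drop N es \<in> permutations_of_set (A - set (take N es))"
        using d(1) by (auto simp: permutations_of_set_def)
    qed
  qed
  then have "card {es \<in> permutations_of_set A. set (take N es) = U} =
      card (permutations_of_set U \<times> permutations_of_set (A - U))"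
    by (rule bij_betw_same_card[symmetric])
  then show ?thesis
    using U assms(1) by (simp add: card_cartesian_product card_Diff_subset)
qed

text \<open>Each \<open>N\<close>-set is the prefix set of equally many permutations, so the graph
  at time \<open>N\<close> is uniform among those with \<open>N\<close> edges.\<close>

lemma card_permutations_prefix_prop:
  assumes "finite A" "N \<le> card A"
  shows "card {es \<in> permutations_of_set A. Q (set (take N es))} =
    card {U \<in> nsets A N. Q U} * (fact N * fact (card A - N))"
proof -
  let ?P = "\<lambda>U. {es \<in> permutations_of_set A. set (take N es) = U}"
  have "set (take N es) \<in> nsets A N" if "es \<in> permutations_of_set A" for es
    using that assms set_take_subset[of N es]
    by (auto simp: nsets_def permutations_of_set_def distinct_card)
  then have "{es \<in> permutations_of_set A. Q (set (take N es))} = (\<Union>U\<in>{U \<in> nsets A N. Q U}. ?P U)"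
    by auto
  also have "card \<dots> = (\<Sum>U\<in>{U \<in> nsets A N. Q U}. card (?P U))"
    using assms finite_nsets[of A N] by (intro card_UN_disjoint) auto
  also have "\<dots> = (\<Sum>U\<in>{U \<in> nsets A N. Q U}. fact N * fact (card A - N))"
    using assms by (intro sum.cong) (auto simp: card_permutations_prefix)
  finally show ?thesis by simp
qed

text \<open>A ratio of falling factorials: the probability that a uniform \<open>N\<close>-subset of
  an \<open>M\<close>-set contains a fixed \<open>s\<close>-set.\<close>

definition subset_prob :: "nat \<Rightarrow> nat \<Rightarrow> nat \<Rightarrow> real" where
  "subset_prob N M s = (\<Prod>i<s. (real N - real i) / (real M - real i))"

text \<open>Removing \<open>F\<close> maps the \<open>N\<close>-sets containing it bijectively to
  the \<open>(N - card F)\<close>-subsets of the rest; the binomial ratio is peeled off one factor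
  at a time.\<close>

lemma subset_prob_eq:
  assumes "finite A" "N \<le> card A" "F \<subseteq> A" "card F \<le> N"
  shows "real (card {U \<in> nsets A N. F \<subseteq> U}) = subset_prob N (card A) (card F) * real (card (nsets A N))"
proof -
  let ?M = "card A"
  have binom: "real ((?M - s) choose (N - s)) = subset_prob N ?M s * real (?M choose N)" if "s \<le> N" for s
    using that
  proof (induction s)
    case (Suc s)
    have "Suc (N - Suc s) * (Suc (?M - Suc s) choose Suc (N - Suc s)) = Suc (?M - Suc s) * ((?M - Suc s) choose (N - Suc s))"
      by (rule Suc_times_binomial)
    moreover have "Suc (N - Suc s) = N - s" "Suc (?M - Suc s) = ?M - s" using Suc assms by auto
    ultimately have "real (N - s) * real ((?M - s) choose (N - s)) = real (?M - s) * real ((?M - Suc s) choose (N - Suc s))"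
      by (metis of_nat_mult)
    then have "real ((?M - Suc s) choose (N - Suc s)) = (real N - real s) / (real ?M - real s) * real ((?M - s) choose (N - s))"
      using Suc assms by (simp add: of_nat_diff field_simps)
    then show ?case using Suc by (simp add: subset_prob_def)
  qed (simp add: subset_prob_def)
  have fF: "finite F" using assms finite_subset by blast
  have "bij_betw (\<lambda>W. W \<union> F) (nsets (A - F) (N - card F)) {U \<in> nsets A N. F \<subseteq> U}"
  proof (rule bij_betw_byWitness[where f' = "\<lambda>U. U - F"])
    show "(\<lambda>W. W \<union> F) ` nsets (A - F) (N - card F) \<subseteq> {U \<in> nsets A N. F \<subseteq> U}"
    proof clarify
      fix W assume W: "W \<in> nsets (A - F) (N - card F)"
      then have "finite W" "W \<inter> F = {}" using assms(1) by (auto simp: nsets_def intro: finite_subset)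
      then have "card (W \<union> F) = N" using fF W assms(4) by (simp add: card_Un_disjoint nsets_def)
      then show "W \<union> F \<in> nsets A N \<and> F \<subseteq> W \<union> F" using W assms by (auto simp: nsets_def)
    qed
    show "(\<lambda>U. U - F) ` {U \<in> nsets A N. F \<subseteq> U} \<subseteq> nsets (A - F) (N - card F)"
      using fF by (auto simp: nsets_def card_Diff_subset)
  qed (auto simp: nsets_def)
  then have "card {U \<in> nsets A N. F \<subseteq> U} = card (nsets (A - F) (N - card F))"
    by (rule bij_betw_same_card[symmetric])
  also have "\<dots> = (?M - card F) choose (N - card F)"
    using assms(1,3) fF by (simp add: card_nsets card_Diff_subset)
  finally show ?thesis using binom[OF assms(4)] assms(1) by (simp add: card_nsets)
qed

context
  fixes N M :: nat assumes NM: "N \<le> M"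
begin

lemma subset_prob_nonneg: "s \<le> N \<Longrightarrow> 0 \<le> subset_prob N M s"
  unfolding subset_prob_def using NM by (intro prod_nonneg) auto

lemma subset_prob_le: "s \<le> N \<Longrightarrow> subset_prob N M s \<le> (real N / real M) ^ s"
proof -
  assume s: "s \<le> N"
  have "subset_prob N M s \<le> (\<Prod>i<s. real N / real M)"
    unfolding subset_prob_def
  proof (rule prod_mono)
    fix i assume "i \<in> {..<s}"
    then have i: "i < N" using s by simp
    have "real i * real N \<le> real i * real M" using NM by (intro mult_left_mono) auto
    then show "0 \<le> (real N - real i) / (real M - real i) \<and> (real N - real i) / (real M - real i) \<le> real N / real M"
      using i NM by (simp add: divide_simps algebra_simps)
  qed
  then show ?thesis by simp
qed

lemma subset_prob_ge: "2 * s \<le> N \<Longrightarrow> (real N / real M / 2) ^ s \<le> subset_prob N M s"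
proof -
  assume s: "2 * s \<le> N"
  have "(\<Prod>i<s. real N / real M / 2) \<le> subset_prob N M s"
    unfolding subset_prob_def
  proof (rule prod_mono)
    fix i assume "i \<in> {..<s}"
    then have i: "2 * i < N" using s by simp
    have "real N / real M / 2 \<le> (real N - real i) / real M" using i NM by (simp add: divide_simps)
    also have "\<dots> \<le> (real N - real i) / (real M - real i)"
      using i NM by (intro divide_left_mono) auto
    finally show "0 \<le> real N / real M / 2 \<and> real N / real M / 2 \<le> (real N - real i) / (real M - real i)" by simp
  qed
  then show ?thesis by simp
qed

text \<open>As \<open>N \<le> M\<close>, shifting the index by \<open>s\<close> only lowers the
  factors. This is negative correlation: edge-disjoint copies contribute no positive
  covariance.\<close>

lemma subset_prob_add_le: "s + t \<le> N \<Longrightarrow> subset_prob N M (s + t) \<le> subset_prob N M s * subset_prob N M t"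
proof -
  assume st: "s + t \<le> N"
  have "subset_prob N M (s + t) = subset_prob N M s * (\<Prod>i<t. (real N - real (s + i)) / (real M - real (s + i)))"
    unfolding subset_prob_def by (induction t) (simp_all add: algebra_simps)
  also have "\<dots> \<le> subset_prob N M s * subset_prob N M t"
  proof (rule mult_left_mono)
    show "(\<Prod>i<t. (real N - real (s + i)) / (real M - real (s + i))) \<le> subset_prob N M t"
      unfolding subset_prob_def
    proof (rule prod_mono)
      fix i assume "i \<in> {..<t}"
      then have i: "s + i < N" using st by simp
      have "real s * real N \<le> real s * real M" using NM by (intro mult_left_mono) auto
      then show "0 \<le> (real N - real (s + i)) / (real M - real (s + i)) \<and>
          (real N - real (s + i)) / (real M - real (s + i)) \<le> (real N - real i) / (real M - real i)"
        using i NM by (simp add: divide_simps algebra_simps)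
    qed
    show "0 \<le> subset_prob N M s" using st by (intro subset_prob_nonneg) auto
  qed
  finally show ?thesis .
qed

end

lemma Kn_edges_eq: "Kn_edges n = nsets {0..<n} 2"
  by (auto simp: Kn_edges_def nsets_def card_2_iff) (metis atLeastLessThan_iff insert_subset)

lemma finite_Kn_edges: "finite (Kn_edges n)"
  by (simp add: Kn_edges_eq finite_nsets)

lemma card_Kn_edges: "card (Kn_edges n) = n choose 2"
  by (simp add: Kn_edges_eq card_nsets)

section \<open>First moment: dense vertex sets\<close>

lemma union_bound:
  assumes "finite A" "N \<le> card A" "finite \<F>" "\<And>F. F \<in> \<F> \<Longrightarrow> F \<subseteq> A \<and> card F = t" "t \<le> N"
  shows "real (card {U \<in> nsets A N. \<exists>F\<in>\<F>. F \<subseteq> U}) \<le>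
    real (card \<F>) * (real N / real (card A)) ^ t * real (card (nsets A N))"
proof -
  have "{U \<in> nsets A N. \<exists>F\<in>\<F>. F \<subseteq> U} = (\<Union>F\<in>\<F>. {U \<in> nsets A N. F \<subseteq> U})" by auto
  then have "real (card {U \<in> nsets A N. \<exists>F\<in>\<F>. F \<subseteq> U}) \<le> (\<Sum>F\<in>\<F>. real (card {U \<in> nsets A N. F \<subseteq> U}))"
    using card_UN_le[OF assms(3), of "\<lambda>F. {U \<in> nsets A N. F \<subseteq> U}"] by (simp flip: of_nat_sum)
  also have "\<dots> \<le> (\<Sum>F\<in>\<F>. (real N / real (card A)) ^ t * real (card (nsets A N)))"
    using assms subset_prob_le[OF assms(2)] subset_prob_eq[OF assms(1,2)]
    by (intro sum_mono) (auto intro!: mult_right_mono)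
  finally show ?thesis by (simp add: mult.assoc)
qed

text \<open>Negative weight on \<open>s\<close> vertices means at least
  \<open>Suc (10 * s div 7)\<close> edges. There are at most \<open>n ^ s\<close> choices of the
  vertices and, crudely, \<open>2 ^ 2 ^ s\<close> of the edges. The number 33 is the edge count for
  \<open>s = 23\<close>.\<close>

lemma not_sparse_bound:
  assumes "N \<le> card (Kn_edges n)" "33 \<le> N"
  shows "real (card {U \<in> nsets (Kn_edges n) N. \<not> sparse U}) \<le>
    (\<Sum>s\<le>23. real n ^ s * 2 ^ 2 ^ s * (real N / real (card (Kn_edges n))) ^ Suc (10 * s div 7)) *
      real (card (nsets (Kn_edges n) N))"
proof -
  let ?A = "Kn_edges n" and ?t = "\<lambda>s. Suc (10 * s div 7)"
  let ?\<F> = "\<lambda>s. \<Union>S\<in>nsets {0..<n} s. {F. F \<subseteq> ?A \<inter> Pow S \<and> card F = ?t s}"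
  let ?B = "\<lambda>s. {U \<in> nsets ?A N. \<exists>F\<in>?\<F> s. F \<subseteq> U}"
  have dense: "\<exists>s\<le>23. U \<in> ?B s" if U: "U \<in> nsets ?A N" "\<not> sparse U" for U
  proof -
    obtain S where S: "finite S" "card S \<le> 23" "wt U S < 0"
      using U(2) by (auto simp: sparse_def not_le)
    \<comment> \<open>\<open>sparse\<close> ranges over all finite sets; cutting \<open>S\<close>
      down to the vertices of the graph keeps its edges and only lowers the weight.\<close>
    let ?S = "S \<inter> {0..<n}"
    have "{e \<in> U. e \<subseteq> S} = {e \<in> U. e \<subseteq> ?S}"
      using U(1) Kn_edges_subset[of n] by (auto simp: nsets_def)
    moreover have le: "card ?S \<le> card S" using S by (intro card_mono) auto
    ultimately have "10 * card ?S < 7 * card {e \<in> U. e \<subseteq> ?S}" using S(3) by (simp add: wt_def)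
    then have "?t (card ?S) \<le> card {e \<in> U. e \<subseteq> ?S}" by simp
    then obtain F where F: "F \<subseteq> {e \<in> U. e \<subseteq> ?S}" "card F = ?t (card ?S)"
      by (rule obtain_subset_with_card_n)
    have "?S \<in> nsets {0..<n} (card ?S)" by (auto simp: nsets_def)
    then have "F \<in> ?\<F> (card ?S)" "F \<subseteq> U" using F U(1) by (auto simp: nsets_def)
    then show ?thesis using U(1) le S(2) by (intro exI[of _ "card ?S"]) auto
  qed
  have each: "real (card (?B s)) \<le> real n ^ s * 2 ^ 2 ^ s * (real N / real (card ?A)) ^ ?t s * real (card (nsets ?A N))"
    if "s \<le> 23" for s
  proof -
    have fin: "finite {F. F \<subseteq> ?A \<inter> Pow S \<and> card F = ?t s}" for S
      using finite_Kn_edges[of n] by auto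
    have "card {F. F \<subseteq> ?A \<inter> Pow S \<and> card F = ?t s} \<le> 2 ^ 2 ^ s" if "S \<in> nsets {0..<n} s" for S
    proof -
      have "finite S" "card S = s" using that by (auto simp: nsets_def intro: finite_subset)
      then have "card (Pow (Pow S)) = 2 ^ 2 ^ s" by (simp add: card_Pow)
      moreover have "card {F. F \<subseteq> ?A \<inter> Pow S \<and> card F = ?t s} \<le> card (Pow (Pow S))"
        using \<open>finite S\<close> by (intro card_mono) auto
      ultimately show ?thesis by simp
    qed
    then have "card (?\<F> s) \<le> (\<Sum>S\<in>nsets {0..<n} s. 2 ^ 2 ^ s)"
      using card_UN_le[of "nsets {0..<n} s" "\<lambda>S. {F. F \<subseteq> ?A \<inter> Pow S \<and> card F = ?t s}"]
        finite_nsets[of "{0..<n}" s]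
      by (meson finite_atLeastLessThan order_trans sum_mono)
    also have "\<dots> = (n choose s) * 2 ^ 2 ^ s" by (simp add: card_nsets)
    also have "\<dots> \<le> n ^ s * 2 ^ 2 ^ s"
      using binomial_le_pow[of s n] by (cases "s \<le> n") (simp_all add: binomial_eq_0)
    finally have "real (card (?\<F> s)) \<le> real (n ^ s * 2 ^ 2 ^ s)" by (rule of_nat_mono)
    then have c: "real (card (?\<F> s)) \<le> real n ^ s * 2 ^ 2 ^ s" by simp
    have "?t s \<le> N" using that assms(2) by auto
    then have "real (card (?B s)) \<le> real (card (?\<F> s)) * (real N / real (card ?A)) ^ ?t s * real (card (nsets ?A N))"
      using assms fin finite_Kn_edges finite_nsets[of "{0..<n}" s] by (intro union_bound) auto
    also have "\<dots> \<le> real n ^ s * 2 ^ 2 ^ s * (real N / real (card ?A)) ^ ?t s * real (card (nsets ?A N))"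
      using c by (intro mult_right_mono) auto
    finally show ?thesis .
  qed
  have "card {U \<in> nsets ?A N. \<not> sparse U} \<le> card (\<Union>s\<in>{..23}. ?B s)"
  proof (rule card_mono)
    show "finite (\<Union>s\<in>{..23}. ?B s)" using finite_nsets[OF finite_Kn_edges, of n N] by simp
    show "{U \<in> nsets ?A N. \<not> sparse U} \<subseteq> (\<Union>s\<in>{..23}. ?B s)"
    proof
      fix U assume "U \<in> {U \<in> nsets ?A N. \<not> sparse U}"
      then have "\<exists>s\<le>23. U \<in> ?B s" by (intro dense) simp_all
      then obtain s where "s \<le> 23" "U \<in> ?B s" by (elim exE conjE)
      then show "U \<in> (\<Union>s\<in>{..23}. ?B s)" by (intro UN_I[of s]) (simp only: atMost_iff)
    qed
  qed
  also have "\<dots> \<le> (\<Sum>s\<in>{..23}. card (?B s))" by (rule card_UN_le) simp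
  finally have "real (card {U \<in> nsets ?A N. \<not> sparse U}) \<le> (\<Sum>s\<in>{..23}. real (card (?B s)))"
    by (simp only: of_nat_sum[symmetric] of_nat_le_iff)
  also have "\<dots> \<le> (\<Sum>s\<in>{..23}. real n ^ s * 2 ^ 2 ^ s * (real N / real (card ?A)) ^ ?t s * real (card (nsets ?A N)))"
    using each by (intro sum_mono) simp
  finally show ?thesis by (simp only: sum_distrib_right)
qed

text \<open>Only embeddings that put vertex \<open>i\<close> into the \<open>i\<close>-th block are counted: two of them can
  share a vertex only by agreeing on it.\<close>
definition embeddings :: "nat \<Rightarrow> (nat \<Rightarrow> nat) set" where
  "embeddings m = (\<Pi>\<^sub>E i\<in>{0..<7}. {i * m..<Suc i * m})"

lemma finite_embeddings: "finite (embeddings m)"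
  unfolding embeddings_def by (intro finite_PiE) auto

lemma card_embeddings: "card (embeddings m) = m ^ 7"
  unfolding embeddings_def by (subst card_PiE) auto

lemma embeddings_block:
  assumes "f \<in> embeddings m" "i < 7" shows "f i div m = i" "f i < 7 * m"
proof -
  have f: "i * m \<le> f i" "f i < Suc i * m" using PiE_mem[of f _ _ i] assms by (auto simp: embeddings_def)
  then show "f i div m = i" by (intro div_nat_eqI) (auto simp: mult.commute)
  have "Suc i * m \<le> 7 * m" using assms by (intro mult_right_mono) auto
  then show "f i < 7 * m" using f by linarith
qed

lemma embeddings_eq:
  assumes "f \<in> embeddings m" "g \<in> embeddings m" "i < 7" "j < 7" "f i = g j" shows "i = j"
  using embeddings_block[OF assms(1,3)] embeddings_block[OF assms(2,4)] assms(5) by simp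

lemma embeddings_inj: "f \<in> embeddings m \<Longrightarrow> inj_on f {0..<7}"
  using embeddings_eq by (intro inj_onI) (metis atLeastLessThan_iff)

lemma embeddings_copy:
  assumes "f \<in> embeddings m" "7 * m \<le> n" shows "DD_copy f \<subseteq> Kn_edges n"
proof
  fix c assume "c \<in> DD_copy f"
  then obtain e where e: "e \<in> DD_edges" "c = f ` e" by blast
  have "e \<subseteq> {0..<7}" "card e = 2" using e(1) by (auto simp: DD_edges_def)
  moreover from this have "card c = 2"
    using e(2) card_image inj_on_subset[OF embeddings_inj[OF assms(1)]] by metis
  moreover have "f i < n" if "i < 7" for i
    using embeddings_block(2)[OF assms(1) that] assms(2) by linarith
  ultimately show "c \<in> Kn_edges n" using e(2) by (auto simp: Kn_edges_eq nsets_def)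
qed

text \<open>The blocks rule out automorphisms of the double diamond, so different embeddings yield
  different copies.\<close>

lemma embeddings_copy_inj: "inj_on DD_copy (embeddings m)"
proof (rule inj_onI)
  fix f g :: "nat \<Rightarrow> nat" assume fg: "f \<in> embeddings m" "g \<in> embeddings m" "DD_copy f = DD_copy g"
  then have im: "f ` {0..<7} = g ` {0..<7}" using Union_DD_copy by metis
  have "f i = g i" if i: "i \<in> {0..<7}" for i
  proof -
    obtain j where j: "j \<in> {0..<7}" "f i = g j" using im i by blast
    then show ?thesis using embeddings_eq[OF fg(1,2), of i j] i by auto
  qed
  then show "f = g" using fg unfolding embeddings_def by (intro PiE_ext[OF fg(1)[unfolded embeddings_def] fg(2)[unfolded embeddings_def]]) auto
qed

section \<open>Second moment: two double diamonds\<close>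

definition agree :: "(nat \<Rightarrow> nat) \<Rightarrow> (nat \<Rightarrow> nat) \<Rightarrow> nat set" where
  "agree f g = {i \<in> {0..<7}. f i = g i}"

lemma card_agree:
  assumes "f \<in> embeddings m" "Q \<subseteq> {0..<7}"
  shows "card {g \<in> embeddings m. agree f g = Q} \<le> m ^ (7 - card Q)"
proof -
  let ?P = "\<Pi>\<^sub>E i\<in>{0..<7}. if i \<in> Q then {f i} else {i * m..<Suc i * m}"
  have "{g \<in> embeddings m. agree f g = Q} \<subseteq> ?P"
  proof
    fix g assume "g \<in> {g \<in> embeddings m. agree f g = Q}"
    then have g: "g \<in> embeddings m" "\<And>i. i \<in> Q \<Longrightarrow> g i = f i" by (auto simp: agree_def)
    then show "g \<in> ?P" unfolding embeddings_def PiE_iff by simp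
  qed
  then have "card {g \<in> embeddings m. agree f g = Q} \<le> card ?P"
    by (intro card_mono finite_PiE) auto
  also have "\<dots> = (\<Prod>i\<in>{0..<7}. if i \<in> Q then 1 else m)"
    by (subst card_PiE) (auto intro!: prod.cong)
  also have "\<dots> = m ^ card ({0..<7} - Q)"
    by (simp add: prod.If_cases Diff_eq)
  also have "card ({0..<7} - Q) = 7 - card Q"
    using assms(2) finite_subset[OF assms(2)] by (simp add: card_Diff_subset)
  finally show ?thesis .
qed

text \<open>By the blocks, a common vertex has the same index in both embeddings, so the common
  vertices are the image of \<open>agree f g\<close>.\<close>

lemma agree_bound:
  assumes "f \<in> embeddings m" "g \<in> embeddings m"
  shows "7 * card (DD_copy f \<inter> DD_copy g) \<le> 10 * card (agree f g)"
proof -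
  have "f ` {0..<7} \<inter> g ` {0..<7} = f ` agree f g"
  proof (intro equalityI subsetI)
    fix v assume "v \<in> f ` {0..<7} \<inter> g ` {0..<7}"
    then obtain i j where ij: "i < 7" "j < 7" "v = f i" "f i = g j" by auto
    then have "i = j" using embeddings_eq[OF assms] by blast
    then show "v \<in> f ` agree f g" using ij by (auto simp: agree_def)
  next
    fix v assume "v \<in> f ` agree f g"
    then obtain i where "i \<in> {0..<7}" "v = f i" "f i = g i" by (auto simp: agree_def)
    then show "v \<in> f ` {0..<7} \<inter> g ` {0..<7}" by (metis IntI imageI)
  qed
  moreover have "card (f ` agree f g) = card (agree f g)"
    by (intro card_image inj_on_subset[OF embeddings_inj[OF assms(1)]]) (auto simp: agree_def)
  ultimately show ?thesis using DD_copy_inter(1)[OF embeddings_inj[OF assms(1)], of g] by simp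
qed

lemma card_copy_Un:
  assumes "f \<in> embeddings m" "g \<in> embeddings m"
  shows "card (DD_copy f \<union> DD_copy g) = 20 - card (DD_copy f \<inter> DD_copy g)"
    "card (DD_copy f \<inter> DD_copy g) \<le> 10"
proof -
  have fin: "finite (DD_copy f)" "finite (DD_copy g)" using finite_DD_edges by auto
  have c: "card (DD_copy f) = 10" "card (DD_copy g) = 10"
    using card_DD_copy embeddings_inj assms by blast+
  show "card (DD_copy f \<union> DD_copy g) = 20 - card (DD_copy f \<inter> DD_copy g)"
    using card_Un_Int[OF fin] unfolding c by linarith
  show "card (DD_copy f \<inter> DD_copy g) \<le> 10"
    using card_mono[OF fin(1), of "DD_copy f \<inter> DD_copy g"] unfolding c by simp
qed

text \<open>\<open>B\<close> bounds the reciprocal of \<open>m ^ a * p ^ j\<close> for every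
  possible overlap with \<open>a\<close> vertices and \<open>j\<close> edges. An overlapping
  \<open>g\<close> thus contributes at most \<open>B * m ^ a * p ^ 20\<close>, and at most
  \<open>m ^ (7 - a)\<close> of them agree with \<open>f\<close> on a given set of size
  \<open>a\<close>.\<close>

lemma overlap_sum_le:
  fixes p B :: real
  assumes p: "0 < p" and m: "0 < m" and f: "f \<in> embeddings m"
    and B: "\<And>a j. 1 \<le> j \<Longrightarrow> j \<le> 10 \<Longrightarrow> a \<le> 7 \<Longrightarrow> 7 * j \<le> 10 * a \<Longrightarrow> 1 \<le> B * (real m ^ a * p ^ j)"
  defines "c \<equiv> \<lambda>g. card (DD_copy f \<inter> DD_copy g)"
  shows "(\<Sum>g\<in>embeddings m. if 1 \<le> c g then p ^ (20 - c g) else 0) \<le> 2 ^ 7 * B * real m ^ 7 * p ^ 20"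
proof -
  let ?h = "\<lambda>g. if 1 \<le> c g then p ^ (20 - c g) else 0"
  have B0: "0 \<le> B"
  proof -
    have "0 < B * (real m ^ 7 * p ^ 1)" using B[of 1 7] by auto
    moreover have "0 < real m ^ 7 * p ^ 1" using p m by auto
    ultimately show ?thesis by (metis zero_less_mult_pos2 less_eq_real_def)
  qed
  have h: "?h g \<le> B * real m ^ card (agree f g) * p ^ 20" if g: "g \<in> embeddings m" for g
  proof (cases "1 \<le> c g")
    case True
    have "card (agree f g) \<le> card {0..<7::nat}" by (intro card_mono) (auto simp: agree_def)
    then have "1 \<le> B * (real m ^ card (agree f g) * p ^ c g)"
      using True agree_bound[OF f g] card_copy_Un(2)[OF f g] by (intro B) (auto simp: c_def)
    then have "p ^ (20 - c g) * 1 \<le> p ^ (20 - c g) * (B * (real m ^ card (agree f g) * p ^ c g))"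
      using p by (intro mult_left_mono) auto
    also have "\<dots> = B * real m ^ card (agree f g) * p ^ (20 - c g + c g)"
      by (simp only: power_add mult_ac)
    \<comment> \<open>Natural subtraction is exact here because \<open>c g \<le> 10\<close>.\<close>
    also have "20 - c g + c g = 20" using card_copy_Un(2)[OF f g] by (simp add: c_def)
    finally show ?thesis using True by simp
  next
    case False
    then show ?thesis using B0 p by simp
  qed
  \<comment> \<open>Grouping by the agreement set gives the factor \<open>2 ^ 7\<close>.\<close>
  have "(\<Sum>g\<in>embeddings m. ?h g) = (\<Sum>Q\<in>Pow {0..<7}. \<Sum>g\<in>{g \<in> embeddings m. agree f g = Q}. ?h g)"
    by (rule sum.group[symmetric]) (auto simp: finite_embeddings agree_def)
  also have "\<dots> \<le> (\<Sum>Q\<in>Pow {0..<7::nat}. B * real m ^ 7 * p ^ 20)"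
  proof (rule sum_mono)
    fix Q :: "nat set" assume Q: "Q \<in> Pow {0..<7}"
    then have "card Q \<le> card {0..<7::nat}" by (intro card_mono) auto
    then have cQ: "7 - card Q + card Q = 7" by simp
    have "(\<Sum>g\<in>{g \<in> embeddings m. agree f g = Q}. ?h g) \<le> (\<Sum>g\<in>{g \<in> embeddings m. agree f g = Q}. B * real m ^ card Q * p ^ 20)"
    proof (rule sum_mono)
      fix g assume "g \<in> {g \<in> embeddings m. agree f g = Q}"
      then show "?h g \<le> B * real m ^ card Q * p ^ 20" using h[of g] by simp
    qed
    also have "\<dots> = real (card {g \<in> embeddings m. agree f g = Q}) * (B * real m ^ card Q * p ^ 20)"
      by simp
    also have "\<dots> \<le> real m ^ (7 - card Q) * (B * real m ^ card Q * p ^ 20)"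
    proof (rule mult_right_mono)
      show "real (card {g \<in> embeddings m. agree f g = Q}) \<le> real m ^ (7 - card Q)"
        using card_agree[OF f, of Q] Q by (metis PowD of_nat_le_iff of_nat_power)
    qed (use B0 p in auto)
    also have "\<dots> = B * real m ^ (7 - card Q + card Q) * p ^ 20"
      by (simp only: power_add mult_ac)
    finally show "(\<Sum>g\<in>{g \<in> embeddings m. agree f g = Q}. ?h g) \<le> B * real m ^ 7 * p ^ 20"
      unfolding cQ .
  qed
  also have "\<dots> = 2 ^ 7 * B * real m ^ 7 * p ^ 20" by (simp add: card_Pow)
  finally show ?thesis .
qed

text \<open>Chebyshev's inequality for the number \<open>?X\<close> of embeddings present, with mean
  \<open>\<mu>\<close>: having fewer than two copies forces \<open>?X \<le> 1\<close>, a deviation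
  of at least \<open>\<mu> - 1\<close>.\<close>

lemma few_DD_bound:
  fixes n m N :: nat and B :: real
  defines "M \<equiv> card (Kn_edges n)"
  defines "p \<equiv> real N / real M"
  assumes N: "40 \<le> N" "N \<le> M" and m: "7 * m \<le> n" "0 < m"
    and B: "\<And>a j. 1 \<le> j \<Longrightarrow> j \<le> 10 \<Longrightarrow> a \<le> 7 \<Longrightarrow> 7 * j \<le> 10 * a \<Longrightarrow> 1 \<le> B * (real m ^ a * p ^ j)"
    and B_small: "B * 2 ^ 11 \<le> 1"
  shows "real (card {U \<in> nsets (Kn_edges n) N. \<not> has_k_DD 2 U}) \<le> 2 ^ 29 * B * real (card (nsets (Kn_edges n) N))"
proof -
  let ?\<Omega> = "nsets (Kn_edges n) N" and ?I = "embeddings m"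
  let ?K = "real (card ?\<Omega>)" and ?q = "subset_prob N M"
  let ?i = "\<lambda>f U. if DD_copy f \<subseteq> U then 1 else (0::real)"
  let ?X = "\<lambda>U. \<Sum>f\<in>?I. ?i f U"
  let ?c = "\<lambda>f g. card (DD_copy f \<inter> DD_copy g)"
  have fin: "finite ?\<Omega>" using finite_nsets finite_Kn_edges by blast
  have p: "0 < p" "p \<le> 1" using N by (auto simp: p_def)
  define \<mu> where "\<mu> = real m ^ 7 * ?q 10"
  have K: "(\<Sum>U\<in>?\<Omega>. if F \<subseteq> U then 1 else (0::real)) = ?q (card F) * ?K"
    if "F \<subseteq> Kn_edges n" "card F \<le> N" for F
    using subset_prob_eq[OF finite_Kn_edges N(2)[unfolded M_def] that] fin
    by (simp add: sum.If_cases Int_def M_def)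
  have EX: "(\<Sum>U\<in>?\<Omega>. ?X U) = \<mu> * ?K"
  proof -
    have "(\<Sum>U\<in>?\<Omega>. ?X U) = (\<Sum>f\<in>?I. \<Sum>U\<in>?\<Omega>. ?i f U)" by (rule sum.swap)
    also have "\<dots> = (\<Sum>f\<in>?I. ?q 10 * ?K)"
    proof (rule sum.cong[OF refl])
      fix f assume f: "f \<in> ?I"
      have "card (DD_copy f) = 10" using card_DD_copy embeddings_inj[OF f] by blast
      then show "(\<Sum>U\<in>?\<Omega>. ?i f U) = ?q 10 * ?K"
        using K[OF embeddings_copy[OF f m(1)]] N by simp
    qed
    finally show ?thesis by (simp add: card_embeddings \<mu>_def)
  qed
  have EX2: "(\<Sum>U\<in>?\<Omega>. (?X U)\<^sup>2) \<le> (\<mu>\<^sup>2 + 2 ^ 7 * B * real m ^ 14 * p ^ 20) * ?K"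
  proof -
    have "(\<Sum>U\<in>?\<Omega>. (?X U)\<^sup>2) = (\<Sum>U\<in>?\<Omega>. \<Sum>f\<in>?I. \<Sum>g\<in>?I. if DD_copy f \<union> DD_copy g \<subseteq> U then 1 else 0)"
      unfolding power2_eq_square sum_product by (intro sum.cong refl) auto
    also have "\<dots> = (\<Sum>f\<in>?I. \<Sum>U\<in>?\<Omega>. \<Sum>g\<in>?I. if DD_copy f \<union> DD_copy g \<subseteq> U then 1 else 0)"
      by (rule sum.swap)
    also have "\<dots> = (\<Sum>f\<in>?I. \<Sum>g\<in>?I. \<Sum>U\<in>?\<Omega>. if DD_copy f \<union> DD_copy g \<subseteq> U then 1 else 0)"
      by (intro sum.cong refl) (rule sum.swap)
    also have "\<dots> = (\<Sum>f\<in>?I. \<Sum>g\<in>?I. ?q (20 - ?c f g) * ?K)"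
    proof (intro sum.cong refl)
      fix f g assume fg: "f \<in> ?I" "g \<in> ?I"
      then have "DD_copy f \<union> DD_copy g \<subseteq> Kn_edges n" using embeddings_copy[OF _ m(1)] by blast
      then show "(\<Sum>U\<in>?\<Omega>. if DD_copy f \<union> DD_copy g \<subseteq> U then 1 else 0) = ?q (20 - ?c f g) * ?K"
        using K[of "DD_copy f \<union> DD_copy g"] N(1) unfolding card_copy_Un(1)[OF fg] by simp
    qed
    \<comment> \<open>Edge-disjoint pairs are handled by \<open>subset_prob_add_le\<close>, all
      others by the crude bound \<open>p ^ (20 - ?c f g)\<close>.\<close>
    also have "\<dots> \<le> (\<Sum>f\<in>?I. \<Sum>g\<in>?I. ((?q 10)\<^sup>2 + (if 1 \<le> ?c f g then p ^ (20 - ?c f g) else 0)) * ?K)"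
    proof (intro sum_mono mult_right_mono)
      fix f g assume fg: "f \<in> ?I" "g \<in> ?I"
      show "?q (20 - ?c f g) \<le> (?q 10)\<^sup>2 + (if 1 \<le> ?c f g then p ^ (20 - ?c f g) else 0)"
      proof (cases "1 \<le> ?c f g")
        case True
        have "?q (20 - ?c f g) \<le> p ^ (20 - ?c f g)"
          unfolding p_def using N by (intro subset_prob_le) auto
        then show ?thesis using True by (auto intro: add_increasing)
      next
        case False
        then have "?c f g = 0" by simp
        then show ?thesis using subset_prob_add_le[OF N(2), of 10 10] N(1) by (simp add: power2_eq_square)
      qed
    qed auto
    also have "\<dots> = (\<Sum>f\<in>?I. (\<Sum>g\<in>?I. (?q 10)\<^sup>2) + (\<Sum>g\<in>?I. if 1 \<le> ?c f g then p ^ (20 - ?c f g) else 0)) * ?K"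
      by (simp only: sum_distrib_right[symmetric] sum.distrib)
    also have "\<dots> \<le> (\<Sum>f\<in>?I. real m ^ 7 * (?q 10)\<^sup>2 + 2 ^ 7 * B * real m ^ 7 * p ^ 20) * ?K"
    proof (intro mult_right_mono sum_mono add_mono)
      fix f assume f: "f \<in> ?I"
      show "(\<Sum>g\<in>?I. (?q 10)\<^sup>2) \<le> real m ^ 7 * (?q 10)\<^sup>2" by (simp add: card_embeddings)
      show "(\<Sum>g\<in>?I. if 1 \<le> ?c f g then p ^ (20 - ?c f g) else 0) \<le> 2 ^ 7 * B * real m ^ 7 * p ^ 20"
        using overlap_sum_le[OF p(1) m(2) f B] by blast
    qed auto
    also have "\<dots> = (\<mu>\<^sup>2 + 2 ^ 7 * B * real m ^ 14 * p ^ 20) * ?K"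
    proof -
      have "real m ^ 14 = real m ^ 7 * real m ^ 7" by (simp flip: power_add)
      then show ?thesis by (simp add: card_embeddings \<mu>_def power2_eq_square algebra_simps)
    qed
    finally show ?thesis .
  qed
  have \<mu>_ge: "real m ^ 7 * (p / 2) ^ 10 \<le> \<mu>"
    unfolding \<mu>_def p_def using subset_prob_ge[OF N(2), of 10] N(1) by (intro mult_left_mono) auto
  \<comment> \<open>The overlap in all 7 vertices and 10 edges gives
    \<open>B * m ^ 7 * p ^ 10 \<ge> 1\<close>, so \<open>B * 2 ^ 11 \<le> 1\<close> yields the claim
    after the loss of \<open>2 ^ 10\<close>.\<close>
  have "2 \<le> \<mu>"
  proof -
    have "1 * 2 \<le> B * (real m ^ 7 * p ^ 10) * 2" using B[of 10 7] by simp
    also have "\<dots> = B * 2 ^ 11 * (real m ^ 7 * (p / 2) ^ 10)" by (simp add: power_divide)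
    also have "\<dots> \<le> 1 * (real m ^ 7 * (p / 2) ^ 10)" using B_small p by (intro mult_right_mono) auto
    finally show ?thesis using \<mu>_ge by simp
  qed
  have small: "?X U \<le> 1" if U: "U \<in> ?\<Omega>" "\<not> has_k_DD 2 U" for U
  proof -
    have "finite U" using U finite_Kn_edges by (auto simp: nsets_def intro: finite_subset)
    have "card {f \<in> ?I. DD_copy f \<subseteq> U} = card (DD_copy ` {f \<in> ?I. DD_copy f \<subseteq> U})"
      by (intro card_image[symmetric] inj_on_subset[OF embeddings_copy_inj[of m]]) auto
    also have "\<dots> \<le> card (DD_copies U)"
      using finite_DD_copies[OF \<open>finite U\<close>] embeddings_inj[of _ m] by (intro card_mono) (auto simp: DD_copies_def)
    also have "\<dots> \<le> 1" using U(2) by (simp add: has_k_DD_def)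
    finally show ?thesis using finite_embeddings[of m] by (simp add: sum.If_cases Int_def)
  qed
  let ?S = "{U \<in> ?\<Omega>. \<not> has_k_DD 2 U}"
  have "real (card ?S) * (\<mu> - 1)\<^sup>2 = (\<Sum>U\<in>?S. (\<mu> - 1)\<^sup>2)" by simp
  also have "\<dots> \<le> (\<Sum>U\<in>?S. (\<mu> - ?X U)\<^sup>2)"
    using small \<open>2 \<le> \<mu>\<close> by (intro sum_mono power_mono) auto
  also have "\<dots> \<le> (\<Sum>U\<in>?\<Omega>. (\<mu> - ?X U)\<^sup>2)"
    using fin by (intro sum_mono2) auto
  also have "\<dots> = (\<Sum>U\<in>?\<Omega>. \<mu>\<^sup>2 - 2 * \<mu> * ?X U + (?X U)\<^sup>2)"
    by (simp only: power2_diff) (simp add: algebra_simps)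
  also have "\<dots> = \<mu>\<^sup>2 * ?K - 2 * \<mu> * (\<Sum>U\<in>?\<Omega>. ?X U) + (\<Sum>U\<in>?\<Omega>. (?X U)\<^sup>2)"
    by (simp only: sum.distrib sum_subtractf sum_distrib_left sum_constant mult.commute[of "of_nat _"])
  also have "\<dots> \<le> 2 ^ 7 * B * real m ^ 14 * p ^ 20 * ?K"
    using EX2 unfolding EX by (simp add: algebra_simps power2_eq_square)
  finally have var: "real (card ?S) * (\<mu> - 1)\<^sup>2 \<le> 2 ^ 7 * B * real m ^ 14 * p ^ 20 * ?K" .
  \<comment> \<open>Since \<open>\<mu> \<ge> 2\<close>, also
    \<open>\<mu> - 1 \<ge> \<mu> / 2\<close>. The square costs \<open>2 ^ 22\<close>, which together
    with \<open>2 ^ 7\<close> from the variance makes \<open>2 ^ 29\<close>.\<close>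
  have "(real m ^ 7 * (p / 2) ^ 10 / 2)\<^sup>2 \<le> (\<mu> - 1)\<^sup>2"
    using \<mu>_ge \<open>2 \<le> \<mu>\<close> p by (intro power_mono) auto
  moreover have "(real m ^ 7 * (p / 2) ^ 10 / 2)\<^sup>2 = real m ^ 14 * p ^ 20 / 2 ^ 22"
    by (simp add: power_divide power_mult_distrib flip: power_mult)
  ultimately have "real (card ?S) * (real m ^ 14 * p ^ 20 / 2 ^ 22) \<le> real (card ?S) * (\<mu> - 1)\<^sup>2"
    by (intro mult_left_mono) auto
  also note var
  finally have "real (card ?S) * (real m ^ 14 * p ^ 20) \<le> 2 ^ 29 * B * ?K * (real m ^ 14 * p ^ 20)"
    by (simp add: field_simps)
  then show ?thesis using p m by (simp add: mult_le_cancel_right)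
qed

section \<open>The random graph process\<close>

text \<open>As \<open>Q\<close> holds at time \<open>N\<close>, both minima are at most
  \<open>N\<close>, where the two properties agree.\<close>

lemma hitting_time_cong:
  assumes "N \<le> length es" "\<And>i. i \<le> N \<Longrightarrow> P (proc_graph es i) \<longleftrightarrow> Q (proc_graph es i)" "Q (proc_graph es N)"
  shows "hitting_time es P = hitting_time es Q"
proof -
  have PN: "P (proc_graph es N)" using assms by blast
  have "(LEAST i. P (proc_graph es i)) = (LEAST i. Q (proc_graph es i))"
  proof (rule Least_equality)
    let ?l = "LEAST i. Q (proc_graph es i)"
    have "?l \<le> N" by (rule Least_le) (rule assms(3))
    then show "P (proc_graph es ?l)" using assms(2) LeastI[of "\<lambda>i. Q (proc_graph es i)", OF assms(3)] by blast
    fix i assume i: "P (proc_graph es i)"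
    show "?l \<le> i"
    proof (cases "i \<le> N")
      case True
      then show ?thesis using assms(2) i by (intro Least_le) blast
    next
      case False
      then show ?thesis using \<open>?l \<le> N\<close> by simp
    qed
  qed
  then show ?thesis using assms(1,3) PN unfolding hitting_time_def by auto
qed

lemma hitting_times_eq:
  assumes es: "es \<in> permutations_of_set (Kn_edges n)" and N: "N \<le> card (Kn_edges n)" and "0 < n"
    and good: "sparse (set (take N es))" "has_k_DD 2 (set (take N es))"
  shows "hitting_time es (maker_first_win n) = hitting_time es (has_k_DD 1)"
    and "hitting_time es (maker_second_win n) = hitting_time es (has_k_DD 2)"
proof -
  have s: "set es = Kn_edges n" "length es = card (Kn_edges n)"
    using es distinct_card[of es] by (auto simp: permutations_of_set_def)
  have G: "proc_graph es i \<subseteq> Kn_edges n" "sparse (proc_graph es i)" if "i \<le> N" for i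
  proof -
    show "proc_graph es i \<subseteq> Kn_edges n" using s set_take_subset[of i es] by (simp add: proc_graph_def)
    show "sparse (proc_graph es i)"
      unfolding proc_graph_def using that by (intro sparse_subset[OF good(1)] set_take_subset_set_take) auto
  qed
  have DD1: "has_k_DD 1 (proc_graph es N)" using good(2) by (simp add: proc_graph_def has_k_DD_def)
  show "hitting_time es (maker_first_win n) = hitting_time es (has_k_DD 1)"
    using N s(2) G DD1 by (intro hitting_time_cong[of N]) (auto simp: maker_first_win_iff)
  show "hitting_time es (maker_second_win n) = hitting_time es (has_k_DD 2)"
    using N s(2) G good(2) \<open>0 < n\<close>
    by (intro hitting_time_cong[of N]) (auto simp: maker_second_win_iff proc_graph_def)
qed

lemma proc_prob_le_1: "proc_prob n Q \<le> 1"
proof -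
  have le: "real a / real b \<le> 1" if "a \<le> b" for a b :: nat
    using that by (cases "b = 0") auto
  show ?thesis
    unfolding proc_prob_def by (rule le) (auto simp del: card_permutations_of_set intro!: card_mono)
qed

text \<open>The event only has to follow from a property of the first \<open>N\<close> edges, and
  these form a uniform \<open>N\<close>-set.\<close>

lemma proc_prob_ge:
  assumes N: "N \<le> card (Kn_edges n)"
    and Q: "\<And>es. es \<in> permutations_of_set (Kn_edges n) \<Longrightarrow> R (set (take N es)) \<Longrightarrow> Q es"
  shows "1 - real (card {U \<in> nsets (Kn_edges n) N. \<not> R U}) / real (card (nsets (Kn_edges n) N)) \<le> proc_prob n Q"
proof -
  let ?A = "Kn_edges n" and ?\<Omega> = "nsets (Kn_edges n) N"
  let ?c = "fact N * fact (card ?A - N) :: nat"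
  have fin: "finite ?\<Omega>" using finite_nsets finite_Kn_edges by blast
  have pos: "0 < card ?\<Omega>" using N by (simp add: card_nsets finite_Kn_edges)
  have "card {U \<in> ?\<Omega>. R U} + card {U \<in> ?\<Omega>. \<not> R U} = card ({U \<in> ?\<Omega>. R U} \<union> {U \<in> ?\<Omega>. \<not> R U})"
    using fin by (intro card_Un_disjoint[symmetric]) auto
  also have "{U \<in> ?\<Omega>. R U} \<union> {U \<in> ?\<Omega>. \<not> R U} = ?\<Omega>" by blast
  finally have "real (card {U \<in> ?\<Omega>. R U}) = real (card ?\<Omega>) - real (card {U \<in> ?\<Omega>. \<not> R U})" by linarith
  then have "1 - real (card {U \<in> ?\<Omega>. \<not> R U}) / real (card ?\<Omega>) = real (card {U \<in> ?\<Omega>. R U}) / real (card ?\<Omega>)"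
    using pos by (simp add: field_simps)
  also have "\<dots> = real (card {U \<in> ?\<Omega>. R U} * ?c) / real (card ?\<Omega> * ?c)" by simp
  also have "\<dots> = real (card {es \<in> permutations_of_set ?A. R (set (take N es))}) / real (card (permutations_of_set ?A))"
    using card_permutations_prefix_prop[OF finite_Kn_edges N, of R]
      card_permutations_prefix_prop[OF finite_Kn_edges N, of "\<lambda>_. True"] by simp
  also have "\<dots> \<le> proc_prob n Q"
    unfolding proc_prob_def using Q
    by (intro divide_right_mono of_nat_mono card_mono) (auto simp: finite_Kn_edges)
  finally show ?thesis .
qed

text \<open>Up to this time the density is at most \<open>8 n powr -0.699\<close>, slightly above the threshold
  \<open>n powr -0.7\<close> of the double diamond, but below that of every denser graph on at most 23 vertices.\<close>
definition horizon :: "nat \<Rightarrow> nat" where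
  "horizon n = nat \<lceil>real n powr (1301 / 1000)\<rceil>"

lemma eventually_powr_ge:
  assumes "0 < (a::real)"
  shows "eventually (\<lambda>n. C \<le> real n powr a) sequentially"
  using eventually_ge_at_top[of "nat \<lceil>max C 1 powr (1 / a)\<rceil>"]
proof eventually_elim
  case (elim n)
  then have "max C 1 powr (1 / a) \<le> real n" by linarith
  then have "(max C 1 powr (1 / a)) powr a \<le> real n powr a" using assms by (intro powr_mono2) auto
  then show ?case using assms by (simp add: powr_powr)
qed

definition density :: "nat \<Rightarrow> real" where
  "density n = real (horizon n) / real (card (Kn_edges n))"

text \<open>Rounding up costs at most a factor 2, and the number of edges lies between
  \<open>n ^ 2 / 4\<close> and \<open>n ^ 2\<close>; hence the factor 8.\<close>

lemma eventually_horizon: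
  "eventually (\<lambda>n. 14 \<le> n \<and> 40 \<le> horizon n \<and> horizon n \<le> card (Kn_edges n) \<and>
     real n powr (-699 / 1000) \<le> density n \<and> density n \<le> 8 * real n powr (-699 / 1000)) sequentially"
proof -
  have "eventually (\<lambda>n. 40 \<le> real n powr (1301 / 1000)) sequentially"
    "eventually (\<lambda>n. 8 \<le> real n powr (699 / 1000)) sequentially"
    by (rule eventually_powr_ge, simp)+
  then show ?thesis using eventually_ge_at_top[of 14]
  proof eventually_elim
    case (elim n)
    let ?x = "real n powr (1301 / 1000)" and ?M = "card (Kn_edges n)"
    have n: "0 < real n" using elim by simp
    have N: "?x \<le> real (horizon n)" "real (horizon n) \<le> 2 * ?x"
      using elim(1) unfolding horizon_def by linarith+
    have M: "real ?M = real n * (real n - 1) / 2"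
      using elim by (simp add: card_Kn_edges choose_two real_of_nat_div of_nat_diff)
    have M1: "real n ^ 2 / 4 \<le> real ?M" "real ?M \<le> real n ^ 2"
      unfolding M using elim by (auto simp: power2_eq_square field_simps)
    have sq: "real n ^ 2 = real n powr 2" using n by (simp add: powr_numeral)
    have x_eq: "?x = real n powr (-699 / 1000) * real n ^ 2"
      unfolding sq by (simp only: powr_add[symmetric]) simp
    have "2 * ?x \<le> real n ^ 2 / 4"
    proof -
      have "8 * ?x \<le> real n powr (699 / 1000) * ?x" using elim by (intro mult_right_mono) auto
      also have "\<dots> = real n ^ 2" unfolding sq by (simp only: powr_add[symmetric]) simp
      finally show ?thesis by simp
    qed
    then have NM: "horizon n \<le> ?M" using N(2) M1(1) by linarith
    have M0: "0 < real ?M" using M1(1) n by (smt (verit) zero_less_power divide_pos_pos)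
    have "real n powr (-699 / 1000) * real ?M \<le> real n powr (-699 / 1000) * real n ^ 2"
      using M1 by (intro mult_left_mono) auto
    then have lo: "real n powr (-699 / 1000) \<le> density n"
      using N(1) M0 unfolding density_def x_eq by (simp add: le_divide_eq)
    have "2 * ?x \<le> 8 * real n powr (-699 / 1000) * (real n ^ 2 / 4)" unfolding x_eq by simp
    also have "\<dots> \<le> 8 * real n powr (-699 / 1000) * real ?M" using M1 by (intro mult_left_mono) auto
    finally have hi: "density n \<le> 8 * real n powr (-699 / 1000)"
      using order_trans[OF N(2)] M0 unfolding density_def by (simp only: divide_le_eq if_True)
    show ?case using elim N NM lo hi by linarith
  qed
qed

definition dense_bound :: "nat \<Rightarrow> real" where
  "dense_bound n = (\<Sum>s\<le>23. real n ^ s * 2 ^ 2 ^ s * density n ^ Suc (10 * s div 7))"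

lemma dense_bound_tendsto: "dense_bound \<longlonglongrightarrow> 0"
proof -
  let ?t = "\<lambda>s. Suc (10 * s div 7)"
  have "(\<lambda>n. real n ^ s * 2 ^ 2 ^ s * density n ^ ?t s) \<longlonglongrightarrow> 0" if "s \<le> 23" for s
  proof (rule tendsto_sandwich)
    let ?e = "real s - 699 / 1000 * real (?t s)" and ?C = "2 ^ 2 ^ s * 8 ^ ?t s :: real"
    show "eventually (\<lambda>n. 0 \<le> real n ^ s * 2 ^ 2 ^ s * density n ^ ?t s) sequentially"
      by (simp add: density_def)
    show "eventually (\<lambda>n. real n ^ s * 2 ^ 2 ^ s * density n ^ ?t s \<le> ?C * real n powr ?e) sequentially"
      using eventually_horizon
    proof eventually_elim
      case (elim n)
      then have n: "0 < real n" by simp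
      have "density n ^ ?t s \<le> (8 * real n powr (-699 / 1000)) ^ ?t s"
        using elim by (intro power_mono) (auto simp: density_def)
      also have "\<dots> = 8 ^ ?t s * real n powr (-699 / 1000 * real (?t s))"
        using powr_power[of "real n" "-699 / 1000" "?t s"] n
        by (simp only: power_mult_distrib mult.commute[of "real (?t s)"] less_irrefl not_False_eq_True)
      finally have "real n ^ s * 2 ^ 2 ^ s * density n ^ ?t s \<le>
          real n powr real s * 2 ^ 2 ^ s * (8 ^ ?t s * real n powr (-699 / 1000 * real (?t s)))"
        using n by (simp only: powr_realpow) (intro mult_left_mono, auto)
      also have "\<dots> = ?C * (real n powr real s * real n powr (-699 / 1000 * real (?t s)))"
        by (simp only: mult_ac)
      also have "real n powr real s * real n powr (-699 / 1000 * real (?t s)) = real n powr ?e"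
        by (simp only: powr_add[symmetric]) (simp add: algebra_simps)
      finally show ?case .
    qed
    \<comment> \<open>With \<open>t = ?t s\<close>, \<open>1000 * s \<le> 700 * t - 100\<close>,
      which is below \<open>699 * t\<close> as long as \<open>t < 100\<close>.\<close>
    have "10 * s + 1 \<le> 7 * ?t s" "?t s \<le> 33" using that by auto
    then have "1000 * s < 699 * ?t s" by linarith
    then have "1000 * real s < 699 * real (?t s)" by linarith
    then have "?e < 0" by simp
    then have "(\<lambda>n. real n powr ?e) \<longlonglongrightarrow> 0"
      by (intro tendsto_neg_powr filterlim_real_sequentially)
    then show "(\<lambda>n. ?C * real n powr ?e) \<longlonglongrightarrow> 0" by (rule tendsto_mult_right_zero)
  qed simp
  then have "(\<lambda>n. \<Sum>s\<le>23. real n ^ s * 2 ^ 2 ^ s * density n ^ ?t s) \<longlonglongrightarrow> (\<Sum>s\<le>23::nat. 0)"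
    by (intro tendsto_sum) simp
  then show ?thesis unfolding dense_bound_def[abs_def] by simp
qed

text \<open>The value of \<open>B\<close> for \<open>few_DD_bound\<close> with blocks of size
  \<open>n div 7\<close>.\<close>

definition overlap_bound :: "nat \<Rightarrow> real" where
  "overlap_bound n = 14 ^ 7 * real n powr (-1 / 1000)"

lemma overlap_bound_tendsto: "overlap_bound \<longlonglongrightarrow> 0"
proof -
  have "(\<lambda>n. real n powr (-1 / 1000)) \<longlonglongrightarrow> 0"
    by (intro tendsto_neg_powr filterlim_real_sequentially) simp
  then show ?thesis unfolding overlap_bound_def[abs_def] by (rule tendsto_mult_right_zero)
qed

lemma overlap_bound_ge:
  assumes n: "14 \<le> n" and p: "real n powr (-699 / 1000) \<le> p"
    and aj: "1 \<le> j" "a \<le> 7" "7 * j \<le> 10 * a"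
  shows "1 \<le> overlap_bound n * (real (n div 7) ^ a * p ^ j)"
proof -
  have n0: "0 < real n" using n by simp
  \<comment> \<open>From \<open>7 * j \<le> 10 * a\<close> the exponent is at least
    \<open>j / 1000\<close>, and \<open>j \<ge> 1\<close>.\<close>
  have e: "1 / 1000 \<le> real a - 699 / 1000 * real j" using aj by linarith
  \<comment> \<open>Replacing \<open>n div 7\<close> by \<open>n / 14\<close> costs at most
    \<open>14 ^ 7\<close>, as \<open>a \<le> 7\<close>.\<close>
  have "n \<le> 14 * (n div 7)" using n by presburger
  then have m: "real n / 14 \<le> real (n div 7)" by linarith
  have "real n powr (1 / 1000) / 14 ^ 7 \<le> real n powr (real a - 699 / 1000 * real j) / 14 ^ a"
    using n e aj(2) by (intro frac_le powr_mono power_increasing) auto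
  also have "real n powr (real a - 699 / 1000 * real j) = real n powr real a * real n powr (-699 / 1000 * real j)"
    by (simp only: powr_add[symmetric]) (simp add: algebra_simps)
  also have "\<dots> / 14 ^ a = (real n / 14) ^ a * (real n powr (-699 / 1000)) ^ j"
    using n0 by (simp add: powr_realpow powr_power power_divide mult.commute)
  also have "\<dots> \<le> real (n div 7) ^ a * p ^ j"
    using m p by (intro mult_mono power_mono) auto
  finally have "overlap_bound n * (real n powr (1 / 1000) / 14 ^ 7) \<le> overlap_bound n * (real (n div 7) ^ a * p ^ j)"
    by (intro mult_left_mono) (auto simp: overlap_bound_def)
  moreover have "overlap_bound n * (real n powr (1 / 1000) / 14 ^ 7) = 1"
    using n0 by (simp add: overlap_bound_def flip: powr_add)
  ultimately show ?thesis by simp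
qed

lemma eventually_proc_prob_ge:
  assumes Q: "\<And>n es N. es \<in> permutations_of_set (Kn_edges n) \<Longrightarrow> N \<le> card (Kn_edges n) \<Longrightarrow> 0 < n \<Longrightarrow>
    sparse (set (take N es)) \<Longrightarrow> has_k_DD 2 (set (take N es)) \<Longrightarrow> Q n es"
  shows "eventually (\<lambda>n. 1 - (dense_bound n + 2 ^ 29 * overlap_bound n) \<le> proc_prob n (Q n)) sequentially"
proof -
  \<comment> \<open>This is the smallness of \<open>B\<close> required by
    \<open>few_DD_bound\<close>.\<close>
  have "eventually (\<lambda>n. overlap_bound n < 1 / 2 ^ 11) sequentially"
    using overlap_bound_tendsto by (rule order_tendstoD) simp
  with eventually_horizon show ?thesis
  proof eventually_elim
    case (elim n)
    let ?N = "horizon n" and ?\<Omega> = "nsets (Kn_edges n) (horizon n)"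
    have fin: "finite ?\<Omega>" using finite_nsets finite_Kn_edges by blast
    have pos: "0 < real (card ?\<Omega>)" using elim by (simp add: card_nsets finite_Kn_edges)
    have sp: "real (card {U \<in> ?\<Omega>. \<not> sparse U}) \<le> dense_bound n * real (card ?\<Omega>)"
      unfolding dense_bound_def density_def using elim by (intro not_sparse_bound) auto
    have dd: "real (card {U \<in> ?\<Omega>. \<not> has_k_DD 2 U}) \<le> 2 ^ 29 * overlap_bound n * real (card ?\<Omega>)"
    proof (rule few_DD_bound)
      show "1 \<le> overlap_bound n * (real (n div 7) ^ a * (real ?N / real (card (Kn_edges n))) ^ j)"
        if "1 \<le> j" "j \<le> 10" "a \<le> 7" "7 * j \<le> 10 * a" for a j
        using elim that overlap_bound_ge[of n "density n" j a] by (simp add: density_def)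
    qed (use elim in auto)
    have "card {U \<in> ?\<Omega>. \<not> (sparse U \<and> has_k_DD 2 U)} \<le> card ({U \<in> ?\<Omega>. \<not> sparse U} \<union> {U \<in> ?\<Omega>. \<not> has_k_DD 2 U})"
      using fin by (intro card_mono) auto
    also have "\<dots> \<le> card {U \<in> ?\<Omega>. \<not> sparse U} + card {U \<in> ?\<Omega>. \<not> has_k_DD 2 U}"
      by (rule card_Un_le)
    finally have "real (card {U \<in> ?\<Omega>. \<not> (sparse U \<and> has_k_DD 2 U)}) \<le>
        (dense_bound n + 2 ^ 29 * overlap_bound n) * real (card ?\<Omega>)"
      using sp dd by (simp only: distrib_right of_nat_le_iff[symmetric, where 'a = real] of_nat_add)
    then have "real (card {U \<in> ?\<Omega>. \<not> (sparse U \<and> has_k_DD 2 U)}) / real (card ?\<Omega>) \<le>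
        dense_bound n + 2 ^ 29 * overlap_bound n"
      using pos by (simp add: divide_le_eq)
    moreover have "1 - real (card {U \<in> ?\<Omega>. \<not> (sparse U \<and> has_k_DD 2 U)}) / real (card ?\<Omega>) \<le> proc_prob n (Q n)"
      using elim Q by (intro proc_prob_ge) auto
    ultimately show ?case by linarith
  qed
qed

text \<open>Stated for any event forced by sparseness and two double diamonds at a common time, so
  that it serves both hitting times.\<close>

lemma proc_prob_tendsto_1:
  assumes "\<And>n es N. es \<in> permutations_of_set (Kn_edges n) \<Longrightarrow> N \<le> card (Kn_edges n) \<Longrightarrow> 0 < n \<Longrightarrow>
    sparse (set (take N es)) \<Longrightarrow> has_k_DD 2 (set (take N es)) \<Longrightarrow> Q n es"
  shows "(\<lambda>n. proc_prob n (Q n)) \<longlonglongrightarrow> 1"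
proof (rule tendsto_sandwich)
  show "eventually (\<lambda>n. 1 - (dense_bound n + 2 ^ 29 * overlap_bound n) \<le> proc_prob n (Q n)) sequentially"
    using assms by (rule eventually_proc_prob_ge)
  show "eventually (\<lambda>n. proc_prob n (Q n) \<le> 1) sequentially" by (simp add: proc_prob_le_1)
  have "(\<lambda>n. 1 - (dense_bound n + 2 ^ 29 * overlap_bound n)) \<longlonglongrightarrow> 1 - (0 + 2 ^ 29 * 0)"
    by (intro tendsto_intros dense_bound_tendsto overlap_bound_tendsto)
  then show "(\<lambda>n. 1 - (dense_bound n + 2 ^ 29 * overlap_bound n)) \<longlonglongrightarrow> 1" by simp
qed simp

theorem theorem4:
  shows "((\<lambda>n. proc_prob n (\<lambda>es. hitting_time es (maker_first_win n) = hitting_time es (has_k_DD 1)))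
           \<longlonglongrightarrow> 1) \<and>
         ((\<lambda>n. proc_prob n (\<lambda>es. hitting_time es (maker_second_win n) = hitting_time es (has_k_DD 2)))
           \<longlonglongrightarrow> 1)"
  by (intro conjI proc_prob_tendsto_1 hitting_times_eq)

end
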